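(* Let $f:\mathcal E\to[0,\infty]$ be concave and upper semicontinuous with $S_0:=\operatorname{cl}(\operatorname{dom} f)$ bounded, i.e. $D_0:=D(S_0)<\infty$; let $S_1,\dots,S_m\subseteq\mathcal E$ be closed and convex, $\mathcal S:=\bigcap_{j=1}^m S_j$; let $e_0\in\operatorname{int}S_0$, $R_0:=R_{e_0}(S_0)>0$, and let $e_j\in\operatorname{int}S_j$ for $j=1,\dots,m$. Set $$\varphi_{\mathcal S}=\max\{\gamma_{S_1,e_1},\dots,\gamma_{S_m,e_m}\},\qquad \mathtt{fom}=\mathtt{subgrad}.$$ Suppose there exist $x^*\in\mathcal S$ with $f(x^* )=p^*:=\max_{x\in\mathcal S}f(x)>0$ and $x_{SL}\in\operatorname{int}\mathcal S\cap\operatorname{dom}f$ such that $\eta:=(1-\gamma_{S_0,e_0}(x^* ))(1-\varphi_{\mathcal S}(x_{SL}))>0$. Let $x_0\in\operatorname{dom}f\cap\mathcal S$, $\tau_0=1/f(x_0)$, $b\ge2$. Then, for all $\varepsilon>0$, the Parallel MultiRadial Method with integer $N\ge\log_b\!\big(\frac{bp^*}{c_{\tau_0}\rho\,\varepsilon}\big)$, $N>0$, finds a feasible $\varepsilon$-minimizer, i.e. $y^{best}_i\in\mathcal S$ with $p^*-f(y^{best}_i)\le\varepsilon$, within $O(1/\varepsilon^2)$ iterations $i$ (the $O$ is as $\varepsilon\to0$, with constant depending on the problem data, $x_0$, $b$, but not on $\varepsilon$ or $N$).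
   Context: $\mathcal E$ is a finite-dimensional Euclidean space with inner product and induced norm $\|\cdot\|$. For $f:\mathcal E\to[0,\infty]$: $\operatorname{dom}f=\{x: 0<f(x)<\infty\}$, $\operatorname{hypo}f=\{(x,u)\in\mathcal E\times(0,\infty): f(x)\ge u\}$, and $f$ is concave if $\operatorname{hypo}f$ is convex. For a set $S$ and $e\in S$: $\gamma_{S,e}(x)=\inf\{v>0: e+\frac{x-e}{v}\in S\}$, $R_e(S)=\inf\{\|x-e\|: x\notin S\}$, $D(S)=\sup\{\|x-y\|: x,y\in S\}$. The radial transform is $f^{\Gamma,e}(y)=\sup\{v>0: v f(e+\frac{y-e}{v})\le1\}$, $\sup\emptyset=0$. For $\tau>0$: $\Phi_\tau(y)=\max\{(\tau f)^{\Gamma,e_0}(y),\varphi_{\mathcal S}(y)\}$, $\rho=\frac{R_0}{D_0+R_0}$, $c_\tau=\frac{1}{\tau p^*}\frac{R_0}{D_0+R_0}\eta$. Subgradient method $\mathtt{subgrad}$ on a convex $h$ with target accuracy $\delta$ started at $x$: $y_0=x$, $y_{i+1}=\mathtt{subgrad.step}(y_i,\delta,h)=y_i-\delta g_i/\|g_i\|^2$ with $g_i\in\partial h(y_i)$. Parallel MultiRadial Method (inputs $f,e_0,\varphi_{\mathcal S},x_0\in\operatorname{dom}f\cap\mathcal S$, $b\ge2$, integer $N>0$, first-order method $\mathtt{fom}$). Set $\delta^{(l)}=b^{-l}$ and $\tau^{(l)}_0=1/f(x_0)$ for $l=1,\dots,N$, and initialize instance $l$ of $\mathtt{fom}$ on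 $\Phi_{\tau^{(l)}_0}$ with target accuracy $\delta^{(l)}$ at $y^{(l)}_0=x_0$. For $i=0,1,2,\dots$: (1) for each $l$ set $\tau^{(l)}_{i+1}=\tau^{(l)}_i$ and $y^{(l)}_{i+1}=\mathtt{fom.step}(y^{(l)}_i,\delta^{(l)},\Phi_{\tau^{(l)}_i})$; (2) let $y^{best}_{i+1}$ minimize $1/f$ (i.e. maximize $f$) among all iterates $y^{(l)}_{i'}$, $i'\le i+1$, $1\le l\le N$, produced so far that lie in $\mathcal S$, and $\tau^{best}_{i+1}=1/f(y^{best}_{i+1})$; (3) for each $l$ with $\tau^{best}_{i+1}\le\frac{1}{1+\delta^{(l)}}\tau^{(l)}_i$, set $\tau^{(l)}_{i+1}=\tau^{best}_{i+1}$ and restart (reinitialize) instance $l$ on $\Phi_{\tau^{(l)}_{i+1}}$ with target accuracy $\delta^{(l)}$ at $y^{(l)}_{i+1}=y^{best}_{i+1}$. *)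

theory Defs
  imports "HOL-Analysis.Analysis" "HOL-Library.Landau_Symbols"
begin

section \<open>Concave functions with values in \<open>[0,\<infinity>]\<close>\<close>

definition pos_dom :: "('a \<Rightarrow> ennreal) \<Rightarrow> 'a set" where
  "pos_dom f = {x. 0 < f x \<and> f x < \<infinity>}"

definition hypo :: "('a \<Rightarrow> ennreal) \<Rightarrow> ('a \<times> real) set" where
  "hypo f = {(x, u). 0 < u \<and> ennreal u \<le> f x}"

definition concave_enn :: "('a::real_vector \<Rightarrow> ennreal) \<Rightarrow> bool" where
  "concave_enn f \<longleftrightarrow> convex (hypo f)"

definition usc :: "('a::topological_space \<Rightarrow> ennreal) \<Rightarrow> bool" where
  "usc f \<longleftrightarrow> (\<forall>x a. f x < a \<longrightarrow> (\<forall>\<^sub>F y in nhds x. f y < a))"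

section \<open>Gauges and the radial transform\<close>

text \<open>
  Real-valued, so only meaningful where the set below is nonempty; this is the case
  for every \<open>x\<close> when \<open>e\<close> is an interior point of \<open>S\<close>.
\<close>
definition minkowski_gauge :: "'a::real_vector set \<Rightarrow> 'a \<Rightarrow> 'a \<Rightarrow> real" where
  "minkowski_gauge S e x = Inf {v. 0 < v \<and> e + (1 / v) *\<^sub>R (x - e) \<in> S}"

definition max_gauge :: "nat \<Rightarrow> (nat \<Rightarrow> 'a::real_vector set) \<Rightarrow> (nat \<Rightarrow> 'a) \<Rightarrow> 'a \<Rightarrow> real" where
  "max_gauge m S e x = Max ((\<lambda>j. minkowski_gauge (S j) (e j) x) ` {1..m})"

definition inner_radius :: "'a::real_normed_vector \<Rightarrow> 'a set \<Rightarrow> real" where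
  "inner_radius e S = Inf {norm (x - e) | x. x \<notin> S}"

text \<open>The supremum is taken in \<^typ>\<open>ennreal\<close>, where the supremum of the empty set is \<open>0\<close>.\<close>
definition radial_transform :: "'a::real_vector \<Rightarrow> ('a \<Rightarrow> ennreal) \<Rightarrow> 'a \<Rightarrow> ennreal" where
  "radial_transform e f y =
     Sup {ennreal v | v. 0 < v \<and> ennreal v * f (e + (1 / v) *\<^sub>R (y - e)) \<le> 1}"

definition radial_objective ::
    "('a::real_vector \<Rightarrow> ennreal) \<Rightarrow> 'a \<Rightarrow> ('a \<Rightarrow> real) \<Rightarrow> real \<Rightarrow> 'a \<Rightarrow> ereal" where
  "radial_objective f e0 \<phi> \<tau> y =
     max (enn2ereal (radial_transform e0 (\<lambda>x. ennreal \<tau> * f x) y)) (ereal (\<phi> y))"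

section \<open>The subgradient method\<close>

definition subdifferential :: "('a::real_inner \<Rightarrow> ereal) \<Rightarrow> 'a \<Rightarrow> 'a set" where
  "subdifferential h y =
     {g. \<bar>h y\<bar> \<noteq> \<infinity> \<and> (\<forall>z. h y + ereal (g \<bullet> (z - y)) \<le> h z)}"

text \<open>
  The choice of the subgradient is free, so a step is a relation between consecutive iterates.
  If the zero subgradient is chosen, then \<open>y\<close> minimizes \<open>h\<close> and,
  since \<open>\<delta> / 0 = 0\<close>, the method stays at \<open>y\<close>.
\<close>
definition subgrad_step :: "real \<Rightarrow> ('a::real_inner \<Rightarrow> ereal) \<Rightarrow> 'a \<Rightarrow> 'a \<Rightarrow> bool" where
  "subgrad_step \<delta> h y y' \<longleftrightarrow>
     (\<exists>g \<in> subdifferential h y. y' = y - (\<delta> / (norm g)\<^sup>2) *\<^sub>R g)"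

section \<open>The Parallel MultiRadial Method\<close>

text \<open>
  The predicate describes the possible runs of the method for a memoryless first-order method
  given by its step relation \<open>fom_step \<delta> h y y'\<close>.  For instance \<open>l \<in> {1..N}\<close>
  and iteration \<open>i\<close>:

    \<^item> \<open>z l i\<close> is the iterate produced by the first-order step, before a possible restart;
    \<^item> \<open>y l i\<close> and \<open>\<tau> l i\<close> are the iterate and the parameter at the end of
      iteration \<open>i\<close>, after a possible restart;
    \<^item> \<open>ybest i\<close> is the best feasible iterate; \<open>ybest 0\<close> is not used by the method.

  Restarts only reuse points \<open>ybest i\<close>, so the points \<open>z l i\<close> are all the iterates ever
  produced.  Maximizing \<open>f\<close> over them need not have a unique solution, and the choice is left free.
  The feasible set \<open>Q\<close> is meant to be \<open>{x. \<phi> x \<le> 1}\<close>.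
\<close>
definition parallel_multiradial ::
    "(real \<Rightarrow> ('a::real_vector \<Rightarrow> ereal) \<Rightarrow> 'a \<Rightarrow> 'a \<Rightarrow> bool) \<Rightarrow>
     ('a \<Rightarrow> ennreal) \<Rightarrow> 'a \<Rightarrow> ('a \<Rightarrow> real) \<Rightarrow> 'a set \<Rightarrow> 'a \<Rightarrow> real \<Rightarrow> nat \<Rightarrow>
     (nat \<Rightarrow> nat \<Rightarrow> 'a) \<Rightarrow> (nat \<Rightarrow> nat \<Rightarrow> 'a) \<Rightarrow> (nat \<Rightarrow> nat \<Rightarrow> real) \<Rightarrow> (nat \<Rightarrow> 'a) \<Rightarrow> bool" where
  "parallel_multiradial fom_step f e0 \<phi> Q x0 b N z y \<tau> ybest \<longleftrightarrow>
     (\<forall>l\<in>{1..N}. z l 0 = x0 \<and> y l 0 = x0 \<and> \<tau> l 0 = 1 / enn2real (f x0)) \<and>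
     (\<forall>i.
        (\<forall>l\<in>{1..N}. fom_step (1 / b ^ l) (radial_objective f e0 \<phi> (\<tau> l i)) (y l i) (z l (Suc i))) \<and>
        (let W = {z l i' | l i'. l \<in> {1..N} \<and> i' \<le> Suc i} \<inter> Q;
             \<tau>best = 1 / enn2real (f (ybest (Suc i)))
         in ybest (Suc i) \<in> W \<and> (\<forall>w\<in>W. f w \<le> f (ybest (Suc i))) \<and>
            (\<forall>l\<in>{1..N}.
               if \<tau>best \<le> 1 / (1 + 1 / b ^ l) * \<tau> l i
               then \<tau> l (Suc i) = \<tau>best \<and> y l (Suc i) = ybest (Suc i)
               else \<tau> l (Suc i) = \<tau> l i \<and> y l (Suc i) = z l (Suc i))))"

end

theory Submission imports Defs begin

text \<open>
  Every subgradient of \<open>\<Phi>\<^sub>\<tau>\<close> is bounded by a constant \<open>L\<close>, and moving from \<open>x_star\<close> towards the Slater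
  point \<open>x_SL\<close> gives a reference point where \<open>\<Phi>\<^sub>\<tau>\<close> is below \<open>1\<close> by an amount proportional to
  \<open>p_star - 1 / \<tau>\<close>. Conversely, a value of \<open>\<Phi>\<^sub>\<tau>\<close> below \<open>1\<close> certifies feasibility and, since
  \<open>R0 * p_star \<le> D0 * f e0\<close>, an improvement of \<open>f\<close> that triggers a restart. Hence, as long as the gap
  of the best iterate exceeds a fixed multiple of \<open>b\<^sup>-\<^sup>l\<close>, instance \<open>l\<close> restarts at least once in any
  \<open>O(b\<^sup>2\<^sup>l)\<close> iterations: otherwise the squared distance to the reference point would become negative.
  Each restart gains a fixed multiple of \<open>b\<^sup>-\<^sup>l\<close>, so a bounded number of them lowers the gap from scale
  \<open>b\<^sup>1\<^sup>-\<^sup>l\<close> to scale \<open>b\<^sup>-\<^sup>l\<close>. Summing over \<open>l\<close> gives a geometric series dominated by the last phase,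
  in which \<open>b\<^sup>l\<close> is of order \<open>1 / \<epsilon>\<close>.
\<close>

section \<open>Concave functions and gauges\<close>

lemma concave_ennD:
  assumes "concave_enn f" "0 < u" "ennreal u \<le> f x" "0 < v" "ennreal v \<le> f y" "0 \<le> a" "a \<le> 1"
  shows "ennreal (a * u + (1 - a) * v) \<le> f (a *\<^sub>R x + (1 - a) *\<^sub>R y)"
proof -
  have "(x, u) \<in> hypo f" "(y, v) \<in> hypo f" using assms by (auto simp: hypo_def)
  then have "a *\<^sub>R (x, u) + (1 - a) *\<^sub>R (y, v) \<in> hypo f"
    using assms(1,6,7) unfolding concave_enn_def by (intro convexD) auto
  then show ?thesis by (simp add: hypo_def)
qed

lemma closed_superlevel_if_usc:
  assumes "usc f"
  shows "closed {x. t \<le> f x}"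
proof -
  have "open {x. f x < t}"
  proof (subst open_subopen, rule ballI)
    fix x assume "x \<in> {x. f x < t}"
    then have "\<forall>\<^sub>F y in nhds x. f y < t" using assms by (simp add: usc_def)
    then show "\<exists>T. open T \<and> x \<in> T \<and> T \<subseteq> {x. f x < t}"
      by (auto simp: eventually_nhds)
  qed
  moreover have "- {x. t \<le> f x} = {x. f x < t}" by auto
  ultimately show ?thesis by (simp add: closed_def)
qed

text \<open>
  An infinite value at \<open>x\<close> propagates by concavity to the half-open segment from \<open>x\<close> to
  any point of the domain, and by upper semicontinuity to its endpoint.
\<close>
lemma concave_usc_finite:
  fixes f :: "'a::real_normed_vector \<Rightarrow> ennreal"
  assumes conc: "concave_enn f" and usc: "usc f" and y: "y \<in> pos_dom f"
  shows "f x < \<infinity>"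
proof (rule ccontr)
  assume "\<not> f x < \<infinity>"
  then have fx: "f x = \<infinity>" by (simp add: less_top[symmetric])
  define v where "v = enn2real (f y)"
  have v: "0 < v" "f y = ennreal v"
    using y by (auto simp: v_def pos_dom_def enn2real_positive_iff)
  define w where "w n = (1 / real (Suc n)) *\<^sub>R x + (1 - 1 / real (Suc n)) *\<^sub>R y" for n
  have "ennreal (v + 1) \<le> f (w n)" for n
  proof -
    \<comment> \<open>As \<open>f x\<close> is infinite, any height may be used at \<open>x\<close>;
      this one is chosen so that the weight \<open>1 / real (Suc n)\<close> turns it into
      \<open>v + 1\<close>, uniformly in \<open>n\<close>.\<close>
    have "ennreal (1 / real (Suc n) * (real (Suc n) * (v + 1)) + (1 - 1 / real (Suc n)) * v) \<le> f (w n)"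
      unfolding w_def using v fx by (intro concave_ennD[OF conc]) auto
    moreover have "v + 1 \<le> 1 / real (Suc n) * (real (Suc n) * (v + 1)) + (1 - 1 / real (Suc n)) * v"
      using v(1) by simp
    ultimately show ?thesis using ennreal_leI order_trans by blast
  qed
  moreover have "w \<longlonglongrightarrow> y"
  proof -
    have "w \<longlonglongrightarrow> 0 *\<^sub>R x + (1 - 0) *\<^sub>R y"
      unfolding w_def by (intro tendsto_intros LIMSEQ_Suc[OF lim_1_over_n])
    then show ?thesis by simp
  qed
  ultimately have "y \<in> {x. ennreal (v + 1) \<le> f x}"
    using closed_sequentially[OF closed_superlevel_if_usc[OF usc]] by blast
  then show False using v by (simp add: ennreal_le_iff2)
qed

section \<open>Minkowski gauges\<close>

lemma bdd_below_gauge_set: "bdd_below {v. 0 < v \<and> P v}" for P :: "real \<Rightarrow> bool"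
  by (rule bdd_belowI[of _ 0]) auto

lemma minkowski_gauge_le:
  assumes "0 < v" "e + (1 / v) *\<^sub>R (x - e) \<in> S"
  shows "minkowski_gauge S e x \<le> v"
  unfolding minkowski_gauge_def using assms by (intro cInf_lower bdd_below_gauge_set) auto

lemma gauge_set_nonempty:
  fixes e :: "'a::real_normed_vector"
  assumes "e \<in> interior S"
  obtains v where "0 < v" "e + (1 / v) *\<^sub>R (x - e) \<in> S"
proof -
  obtain r where r: "0 < r" "cball e r \<subseteq> S"
    using assms mem_interior_cball by blast
  \<comment> \<open>At level \<open>(norm (x - e) + 1) / r\<close> the scaled point stays in the
    ball; the summand 1 keeps the level positive when \<open>x = e\<close>.\<close>
  have "norm (x - e) * r \<le> (norm (x - e) + 1) * r" using r by (intro mult_right_mono) auto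
  then have "e + (1 / ((norm (x - e) + 1) / r)) *\<^sub>R (x - e) \<in> cball e r"
    using r by (simp add: dist_norm pos_divide_le_eq add_nonneg_pos mult.commute)
  then show ?thesis
    using that[of "(norm (x - e) + 1) / r"] r by (auto simp: add_nonneg_pos)
qed

lemma minkowski_gauge_approx:
  fixes e :: "'a::real_normed_vector"
  assumes "e \<in> interior S" "minkowski_gauge S e x < w"
  obtains v where "0 < v" "v < w" "e + (1 / v) *\<^sub>R (x - e) \<in> S"
proof -
  have "{v. 0 < v \<and> e + (1 / v) *\<^sub>R (x - e) \<in> S} \<noteq> {}"
    using gauge_set_nonempty[OF assms(1)] by blast
  from cInf_lessD[OF this] assms(2) show ?thesis
    using that unfolding minkowski_gauge_def by blast
qed

lemma minkowski_gauge_nonneg: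
  fixes e :: "'a::real_normed_vector"
  assumes "e \<in> interior S"
  shows "0 \<le> minkowski_gauge S e x"
proof (rule ccontr)
  assume "\<not> ?thesis"
  then obtain v where "0 < v" "v < (0::real)"
    using minkowski_gauge_approx[OF assms, of x 0] by (auto simp: not_le)
  then show False by simp
qed

text \<open>The infimum need not be attained. Convexity shrinks members towards \<open>e\<close> to
  levels \<open>1 + 1 / real (Suc n)\<close>, and closedness allows the limit.\<close>

lemma mem_if_minkowski_gauge_le_1:
  fixes e :: "'a::real_normed_vector"
  assumes S: "closed S" "convex S" and e: "e \<in> interior S" and le: "minkowski_gauge S e x \<le> 1"
  shows "x \<in> S"
proof -
  define w where "w n = 1 + 1 / real (Suc n)" for n
  have "e + (1 / w n) *\<^sub>R (x - e) \<in> S" for n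
  proof -
    have w: "0 < w n" "1 < w n" by (auto simp: w_def add_pos_pos)
    obtain v where v: "0 < v" "v < w n" "e + (1 / v) *\<^sub>R (x - e) \<in> S"
      using minkowski_gauge_approx[OF e] le w by (metis order.strict_trans1)
    have "(1 - v / w n) *\<^sub>R e + (v / w n) *\<^sub>R (e + (1 / v) *\<^sub>R (x - e)) \<in> S"
      using v w e interior_subset[of S] by (intro convexD[OF S(2)]) (auto simp: field_simps)
    moreover have "(1 - v / w n) *\<^sub>R e + (v / w n) *\<^sub>R (e + (1 / v) *\<^sub>R (x - e)) = e + (1 / w n) *\<^sub>R (x - e)"
      using v by (simp add: algebra_simps)
    ultimately show ?thesis by simp
  qed
  moreover have "(\<lambda>n. e + (1 / w n) *\<^sub>R (x - e)) \<longlonglongrightarrow> e + (1 / (1 + 0)) *\<^sub>R (x - e)"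
    unfolding w_def by (intro tendsto_intros LIMSEQ_Suc[OF lim_1_over_n]) auto
  ultimately have "e + (1 / (1 + 0)) *\<^sub>R (x - e) \<in> S"
    by (rule closed_sequentially[OF S(1)])
  then show ?thesis by simp
qed

text \<open>Levels combine linearly: \<open>x\<close> has level 1 as a member of \<open>S\<close>
  and \<open>z\<close> a level \<open>v\<close> near its gauge, so the combination has level
  \<open>1 - l + l * v\<close>.\<close>

lemma minkowski_gauge_convex_comb:
  fixes e :: "'a::real_normed_vector"
  assumes S: "convex S" and e: "e \<in> interior S" and x: "x \<in> S" and l: "0 \<le> l" "l < 1"
  shows "minkowski_gauge S e (x + l *\<^sub>R (z - x)) \<le> 1 - l * (1 - minkowski_gauge S e z)"
proof (rule field_le_epsilon)
  fix k :: real assume k: "0 < k"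
  obtain v where v: "0 < v" "v < minkowski_gauge S e z + k" "e + (1 / v) *\<^sub>R (z - e) \<in> S"
    using minkowski_gauge_approx[OF e] k by (metis less_add_same_cancel1)
  define w where "w = 1 - l + l * v"
  have w: "0 < w" using l v by (simp add: w_def add_pos_nonneg)
  have "((1 - l) / w) *\<^sub>R x + (l * v / w) *\<^sub>R (e + (1 / v) *\<^sub>R (z - e)) \<in> S"
    using x v l w by (intro convexD[OF S]) (auto simp: w_def add_divide_distrib[symmetric])
  moreover have "((1 - l) / w) *\<^sub>R x + (l * v / w) *\<^sub>R (e + (1 / v) *\<^sub>R (z - e))
      = e + (1 / w) *\<^sub>R (x + l *\<^sub>R (z - x) - e)"
  proof -
    have "w *\<^sub>R (((1 - l) / w) *\<^sub>R x + (l * v / w) *\<^sub>R (e + (1 / v) *\<^sub>R (z - e)))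
      = w *\<^sub>R (e + (1 / w) *\<^sub>R (x + l *\<^sub>R (z - x) - e))"
      using w v by (simp add: scaleR_add_right) (simp add: w_def algebra_simps)
    then show ?thesis using w by simp
  qed
  ultimately have "minkowski_gauge S e (x + l *\<^sub>R (z - x)) \<le> w"
    using w by (intro minkowski_gauge_le) auto
  also have "\<dots> \<le> 1 - l * (1 - minkowski_gauge S e z) + k"
  proof -
    have "l * v \<le> l * (minkowski_gauge S e z + k)" using v l by (intro mult_left_mono) auto
    also have "\<dots> \<le> l * minkowski_gauge S e z + k" using l k by (simp add: distrib_left mult_left_le_one_le)
    finally show ?thesis by (simp add: w_def algebra_simps)
  qed
  finally show "minkowski_gauge S e (x + l *\<^sub>R (z - x)) \<le> 1 - l * (1 - minkowski_gauge S e z) + k" .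
qed

text \<open>
  Shared by the Lipschitz estimates of the gauge and of the radial transform: the point that
  belongs to \<open>y + d\<close> at level \<open>v + norm d / R\<close> lies between the one that belongs to
  \<open>y\<close> at level \<open>v\<close> and a point of the ball of radius \<open>R\<close>.
\<close>
lemma scaled_point_split:
  fixes e y d :: "'a::real_normed_vector"
  assumes "0 < v" "0 < R"
  defines "w \<equiv> v + norm d / R"
  obtains u where "u \<in> cball e R"
    "e + (1 / w) *\<^sub>R (y + d - e) = (v / w) *\<^sub>R (e + (1 / v) *\<^sub>R (y - e)) + (1 - v / w) *\<^sub>R u"
proof
  let ?u = "e + R *\<^sub>R sgn d"
  have w: "0 < w" using assms by (simp add: add_pos_nonneg)
  show "?u \<in> cball e R" using assms by (auto simp: dist_norm norm_sgn)
  have d: "(norm d / R) *\<^sub>R (R *\<^sub>R sgn d) = d"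
    using assms by (cases "d = 0") (simp_all add: sgn_div_norm)
  have vw: "w - v = norm d / R" by (simp add: w_def)
  have "w *\<^sub>R ((v / w) *\<^sub>R (e + (1 / v) *\<^sub>R (y - e)) + (1 - v / w) *\<^sub>R ?u)
     = v *\<^sub>R e + (y - e) + (w - v) *\<^sub>R ?u"
    using w assms(1) by (simp add: scaleR_add_right right_diff_distrib)
  also have "(w - v) *\<^sub>R ?u = (w - v) *\<^sub>R e + d"
    using d by (simp add: vw scaleR_add_right)
  also have "v *\<^sub>R e + (y - e) + ((w - v) *\<^sub>R e + d) = w *\<^sub>R (e + (1 / w) *\<^sub>R (y + d - e))"
    using w by (simp add: algebra_simps)
  finally show "e + (1 / w) *\<^sub>R (y + d - e) = (v / w) *\<^sub>R (e + (1 / v) *\<^sub>R (y - e)) + (1 - v / w) *\<^sub>R ?u"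
    using w by simp
qed

lemma minkowski_gauge_Lipschitz:
  fixes e :: "'a::real_normed_vector"
  assumes S: "convex S" and R: "0 < R" "cball e R \<subseteq> S"
  shows "minkowski_gauge S e (y + d) \<le> minkowski_gauge S e y + norm d / R"
proof (rule field_le_epsilon)
  fix k :: real assume k: "0 < k"
  have e: "e \<in> interior S" using R mem_interior_cball by blast
  obtain v where v: "0 < v" "v < minkowski_gauge S e y + k" "e + (1 / v) *\<^sub>R (y - e) \<in> S"
    using minkowski_gauge_approx[OF e] k by (metis less_add_same_cancel1)
  define w where "w = v + norm d / R"
  have w: "0 < w" "v \<le> w" using v R by (auto simp: w_def add_pos_nonneg)
  obtain u where u: "u \<in> cball e R"
    "e + (1 / w) *\<^sub>R (y + d - e) = (v / w) *\<^sub>R (e + (1 / v) *\<^sub>R (y - e)) + (1 - v / w) *\<^sub>R u"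
    using scaled_point_split[OF v(1) R(1)] unfolding w_def by blast
  have "(v / w) *\<^sub>R (e + (1 / v) *\<^sub>R (y - e)) + (1 - v / w) *\<^sub>R u \<in> S"
    using u R v w by (intro convexD[OF S]) auto
  then have "minkowski_gauge S e (y + d) \<le> w"
    using w u by (intro minkowski_gauge_le) auto
  then show "minkowski_gauge S e (y + d) \<le> minkowski_gauge S e y + norm d / R + k"
    using v by (simp add: w_def)
qed

lemma max_gauge_le_iff:
  assumes "1 \<le> m"
  shows "max_gauge m S e x \<le> t \<longleftrightarrow> (\<forall>j\<in>{1..m}. minkowski_gauge (S j) (e j) x \<le> t)"
  unfolding max_gauge_def using assms by (subst Max_le_iff) auto

lemma minkowski_gauge_le_max_gauge:
  "j \<in> {1..m} \<Longrightarrow> minkowski_gauge (S j) (e j) x \<le> max_gauge m S e x"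
  unfolding max_gauge_def by (intro Max_ge) auto

lemma max_gauge_Lipschitz:
  fixes e :: "nat \<Rightarrow> 'a::real_normed_vector"
  assumes m: "1 \<le> m" and S: "\<And>j. j \<in> {1..m} \<Longrightarrow> convex (S j)"
    and e: "\<And>j. j \<in> {1..m} \<Longrightarrow> e j \<in> interior (S j)"
  obtains r where "0 < r" "\<And>y d. max_gauge m S e (y + d) \<le> max_gauge m S e y + norm d / r"
proof -
  have "\<forall>j\<in>{1..m}. \<exists>r>0. cball (e j) r \<subseteq> S j" using e mem_interior_cball by blast
  then obtain r where r: "\<And>j. j \<in> {1..m} \<Longrightarrow> 0 < r j \<and> cball (e j) (r j) \<subseteq> S j" by metis
  define r0 where "r0 = Min (r ` {1..m})"
  have r0: "0 < r0" using r m unfolding r0_def by (subst Min_gr_iff) auto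
  have "max_gauge m S e (y + d) \<le> max_gauge m S e y + norm d / r0" for y d
    unfolding max_gauge_le_iff[OF m]
  proof
    fix j assume j: "j \<in> {1..m}"
    have "r0 \<le> r j" using j unfolding r0_def by (intro Min_le) auto
    then have "cball (e j) r0 \<subseteq> S j" using r[OF j] by (meson order_trans subset_cball)
    from minkowski_gauge_Lipschitz[OF S[OF j] r0 this, of y d] minkowski_gauge_le_max_gauge[OF j, of S e y]
    show "minkowski_gauge (S j) (e j) (y + d) \<le> max_gauge m S e y + norm d / r0" by linarith
  qed
  then show ?thesis using r0 that by blast
qed

text \<open>Points closer to \<open>e\<close> than every outside point lie in \<open>S\<close>,
  which gives the open ball; closedness of \<open>S\<close> adds its boundary.\<close>

lemma cball_inner_radius_subset:
  fixes e :: "'a::real_normed_vector"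
  assumes "closed S" "0 < inner_radius e S"
  shows "cball e (inner_radius e S) \<subseteq> S"
proof -
  have *: "ball e (inner_radius e S) \<subseteq> S"
  proof (rule ccontr)
    assume "\<not> ball e (inner_radius e S) \<subseteq> S"
    then obtain x where x: "x \<notin> S" "norm (x - e) < inner_radius e S"
      by (metis dist_norm mem_ball norm_minus_commute subsetI)
    have "inner_radius e S \<le> norm (x - e)"
      unfolding inner_radius_def using x by (intro cInf_lower bdd_belowI[of _ 0]) auto
    then show False using x by simp
  qed
  show ?thesis using closure_minimal[OF * assms(1)] unfolding closure_ball[OF assms(2)] .
qed

section \<open>The radial transform\<close>

text \<open>Concavity is assumed only between points of positive value because \<open>hypo\<close>
  contains only positive heights. The closure of the positive set becomes \<open>S0\<close>, and
  \<open>R\<close> becomes \<open>R0\<close>.\<close>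

locale radial_function =
  fixes F :: "'a::euclidean_space \<Rightarrow> real" and e0 :: 'a and R :: real
  assumes nonneg: "0 \<le> F x"
    and conc: "0 < F x \<Longrightarrow> 0 < F y \<Longrightarrow> 0 \<le> a \<Longrightarrow> a \<le> 1 \<Longrightarrow>
      a * F x + (1 - a) * F y \<le> F (a *\<^sub>R x + (1 - a) *\<^sub>R y)"
    and closed_superlevel: "closed {x. t \<le> F x}"
    and R_pos: "0 < R"
    and cball_R: "cball e0 R \<subseteq> closure {x. 0 < F x}"
begin

definition pos where "pos = closure {x. 0 < F x}"

lemma convex_pos: "convex pos"
  unfolding pos_def
proof (intro convex_closure convexI)
  fix x y and u v :: real
  assume a: "x \<in> {x. 0 < F x}" "y \<in> {x. 0 < F x}" "0 \<le> u" "0 \<le> v" "u + v = 1"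
  have v: "v = 1 - u" using a by simp
  have "0 < u * F x + v * F y"
    using a by (cases "u = 0") (simp_all add: add_pos_nonneg)
  also have "\<dots> \<le> F (u *\<^sub>R x + v *\<^sub>R y)"
    unfolding v by (rule conc) (use a in simp_all)
  finally show "u *\<^sub>R x + v *\<^sub>R y \<in> {x. 0 < F x}" by simp
qed

lemma mem_pos: "0 < F x \<Longrightarrow> x \<in> pos"
  unfolding pos_def by (rule subsetD[OF closure_subset]) simp

lemma scaled_value_le:
  assumes z: "z \<in> pos" and a: "0 \<le> a" "a \<le> 1"
  shows "a * F x \<le> F (a *\<^sub>R x + (1 - a) *\<^sub>R z)"
proof (cases "0 < F x")
  case True
  let ?C = "{z. a * F x \<le> F (a *\<^sub>R x + (1 - a) *\<^sub>R z)}"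
  have "closed ((\<lambda>z. a *\<^sub>R x + (1 - a) *\<^sub>R z) -` {z. a * F x \<le> F z})"
    by (rule closed_vimage[OF closed_superlevel]) (intro continuous_intros)
  then have C: "closed ?C" by (simp add: vimage_def)
  have "{x. 0 < F x} \<subseteq> ?C"
  proof
    fix z assume z: "z \<in> {x. 0 < F x}"
    have "a * F x \<le> a * F x + (1 - a) * F z" using a z by simp
    also have "\<dots> \<le> F (a *\<^sub>R x + (1 - a) *\<^sub>R z)"
      by (rule conc) (use a z True in simp_all)
    finally show "z \<in> ?C" by simp
  qed
  then have "closure {x. 0 < F x} \<subseteq> ?C" by (rule closure_minimal[OF _ C])
  then show ?thesis using z unfolding pos_def by (simp add: subset_eq)
next
  case False
  then have "F x = 0" using nonneg[of x] by linarith
  then show ?thesis using nonneg[of "a *\<^sub>R x + (1 - a) *\<^sub>R z"] by simp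
qed

text \<open>\<open>e0\<close> lies between a point \<open>x\<close> of positive value and a point of
  the ball on the opposite side, so a positive fraction of \<open>F x\<close> survives at
  \<open>e0\<close>.\<close>

lemma center_pos: "0 < F e0"
proof -
  have "e0 \<in> closure {x. 0 < F x}" using cball_R R_pos by auto
  then obtain x where x: "0 < F x" by fastforce
  define d where "d = x - e0"
  let ?z = "e0 - R *\<^sub>R sgn d"
  have "?z \<in> cball e0 R" using R_pos by (auto simp: dist_norm norm_sgn)
  then have z: "?z \<in> pos" using cball_R by (auto simp: pos_def)
  define a where "a = R / (R + norm d)"
  have a: "0 < a" "a \<le> 1" using R_pos by (auto simp: a_def add_pos_nonneg divide_le_eq_1)
  have "0 < a * F x" using a x by simp
  also have "\<dots> \<le> F (a *\<^sub>R x + (1 - a) *\<^sub>R ?z)" using a by (intro scaled_value_le z) auto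
  also have "a *\<^sub>R x + (1 - a) *\<^sub>R ?z = e0"
  proof -
    have s: "0 < R + norm d" using R_pos by (simp add: add_pos_nonneg)
    have "x = e0 + d" by (simp add: d_def)
    then have "a *\<^sub>R x + (1 - a) *\<^sub>R ?z = e0 + (a *\<^sub>R d - ((1 - a) * R) *\<^sub>R sgn d)"
      by (simp add: algebra_simps)
    also have "(1 - a) * R = a * norm d" using s by (simp add: a_def field_simps)
    also have "(a * norm d) *\<^sub>R sgn d = a *\<^sub>R d"
      by (cases "d = 0") (simp_all add: sgn_div_norm)
    finally show ?thesis by simp
  qed
  finally show ?thesis .
qed

text \<open>Quantitative form of \<open>center_pos\<close>: the surviving fraction is
  \<open>R / s\<close>, where \<open>s\<close> is the distance between two points of
  \<open>pos\<close>, hence at most the diameter.\<close>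

lemma center_value_ge:
  assumes "bounded pos" "0 < F x"
  shows "R * F x \<le> diameter pos * F e0"
proof -
  define d where "d = x - e0"
  \<comment> \<open>A unit vector is needed even for \<open>x = e0\<close>, where
    \<open>sgn d\<close> would vanish and the opposite point would not be at distance
    \<open>R\<close>.\<close>
  obtain u :: 'a where u: "norm u = 1" "d = norm d *\<^sub>R u"
  proof (cases "d = 0")
    case True
    then show ?thesis using that[of "SOME i. i \<in> Basis"] by (simp add: some_in_eq)
  next
    case False
    then show ?thesis using that[of "sgn d"] by (simp add: norm_sgn sgn_div_norm)
  qed
  let ?z = "e0 - R *\<^sub>R u"
  have "?z \<in> cball e0 R" using R_pos u(1) by (auto simp: dist_norm)
  then have z: "?z \<in> pos" using cball_R by (auto simp: pos_def)
  define s where "s = R + norm d"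
  have s: "0 < s" using R_pos by (simp add: s_def add_pos_nonneg)
  have xz: "x - ?z = s *\<^sub>R u"
  proof -
    have "s *\<^sub>R u = R *\<^sub>R u + d" unfolding s_def scaleR_add_left using u(2) by metis
    then show ?thesis by (simp add: d_def)
  qed
  have sD: "s \<le> diameter pos"
    using diameter_bounded_bound[OF assms(1) mem_pos[OF assms(2)] z] s u(1) by (simp add: dist_norm xz)
  have e: "(R / s) *\<^sub>R x + (1 - R / s) *\<^sub>R ?z = e0"
  proof -
    have "(R / s) *\<^sub>R x + (1 - R / s) *\<^sub>R ?z = (R / s) *\<^sub>R (x - ?z) + ?z"
      by (simp add: algebra_simps)
    also have "\<dots> = e0" unfolding xz using s by simp
    finally show ?thesis .
  qed
  have "R / s * F x \<le> F ((R / s) *\<^sub>R x + (1 - R / s) *\<^sub>R ?z)"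
    using s R_pos by (intro scaled_value_le z) (auto simp: s_def)
  then have "R * F x \<le> s * F e0" unfolding e using s by (simp add: field_simps)
  also have "\<dots> \<le> diameter pos * F e0" using sD nonneg by (intro mult_right_mono) auto
  finally show ?thesis .
qed

text \<open>The point at level \<open>w\<close> lies between the point at level \<open>v\<close> and
  \<open>e0\<close>. By concavity the perspective thus grows at least at rate \<open>F e0\<close>
  once positive, so it crosses any threshold only once.\<close>

lemma perspective_growth:
  assumes v: "0 < v" "v \<le> w" and pos: "0 < F (e0 + (1 / v) *\<^sub>R (y - e0))"
  shows "v * F (e0 + (1 / v) *\<^sub>R (y - e0)) + (w - v) * F e0 \<le> w * F (e0 + (1 / w) *\<^sub>R (y - e0))"
proof -
  define x where "x = e0 + (1 / v) *\<^sub>R (y - e0)"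
  have w: "0 < w" using v by linarith
  have a: "0 \<le> v / w" "v / w \<le> 1" using v w by simp_all
  have "v / w * F x + (1 - v / w) * F e0 \<le> F ((v / w) *\<^sub>R x + (1 - v / w) *\<^sub>R e0)"
    using conc[OF pos center_pos a] unfolding x_def .
  also have "(v / w) *\<^sub>R x + (1 - v / w) *\<^sub>R e0 = e0 + (1 / w) *\<^sub>R (y - e0)"
    using v(1) by (simp add: x_def scaleR_add_right scaleR_left_diff_distrib)
  finally have "w * (v / w * F x + (1 - v / w) * F e0) \<le> w * F (e0 + (1 / w) *\<^sub>R (y - e0))"
    using w by (intro mult_left_mono) simp_all
  also have "w * (v / w * F x + (1 - v / w) * F e0) = w * (v / w) * F x + (w - w * (v / w)) * F e0"
    by (simp only: distrib_left right_diff_distrib left_diff_distrib mult.assoc mult_1_left mult_1_right)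
  also have "w * (v / w) = v" using w by simp
  finally show ?thesis unfolding x_def .
qed

section \<open>The radial transform as a crossing level of the perspective\<close>

abbreviation radial :: "real \<Rightarrow> 'a \<Rightarrow> ennreal" where
  "radial \<tau> \<equiv> radial_transform e0 (\<lambda>x. ennreal \<tau> * ennreal (F x))"

lemma radial_eq:
  assumes "0 < \<tau>"
  shows "radial \<tau> y = Sup {ennreal v |v. 0 < v \<and> \<tau> * (v * F (e0 + (1 / v) *\<^sub>R (y - e0))) \<le> 1}"
proof -
  have "ennreal v * (ennreal \<tau> * ennreal (F x)) \<le> 1 \<longleftrightarrow> \<tau> * (v * F x) \<le> 1" if "0 < v" for v x
  proof -
    have "ennreal v * (ennreal \<tau> * ennreal (F x)) = ennreal (\<tau> * (v * F x))"
      using that assms nonneg by (simp add: ennreal_mult[symmetric] mult.left_commute)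
    then show ?thesis by simp
  qed
  then have "{ennreal v |v. 0 < v \<and> ennreal v * (ennreal \<tau> * ennreal (F (e0 + (1 / v) *\<^sub>R (y - e0)))) \<le> 1}
      = {ennreal v |v. 0 < v \<and> \<tau> * (v * F (e0 + (1 / v) *\<^sub>R (y - e0))) \<le> 1}"
    by (intro Collect_cong ex_cong1) auto
  then show ?thesis unfolding radial_transform_def by simp
qed

lemma radial_lessD:
  assumes "0 < \<tau>" "radial \<tau> y < ennreal v"
  shows "1 < \<tau> * (v * F (e0 + (1 / v) *\<^sub>R (y - e0)))"
proof (rule ccontr)
  assume "\<not> ?thesis"
  moreover have "0 < v" using assms(2) by (metis ennreal_less_zero_iff not_gr_zero not_less_zero)
  ultimately have "ennreal v \<le> radial \<tau> y"
    unfolding radial_eq[OF assms(1)] by (intro Sup_upper) auto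
  then show False using assms by simp
qed

lemma value_pos_if_perspective_pos:
  assumes "0 < \<tau> * (v * F x)"
  shows "0 < F x"
  using assms nonneg[of x] by (cases "F x = 0") auto

text \<open>Once the scaled perspective has reached 1, \<open>perspective_growth\<close> keeps it
  strictly above 1 at all larger levels, which are therefore excluded from the supremum.\<close>

lemma radial_le:
  assumes \<tau>: "0 < \<tau>" and v: "0 < v" and ge: "1 \<le> \<tau> * (v * F (e0 + (1 / v) *\<^sub>R (y - e0)))"
  shows "radial \<tau> y \<le> ennreal v"
  unfolding radial_eq[OF \<tau>]
proof (rule Sup_least)
  fix x assume "x \<in> {ennreal v |v. 0 < v \<and> \<tau> * (v * F (e0 + (1 / v) *\<^sub>R (y - e0))) \<le> 1}"
  then obtain w where w: "x = ennreal w" "0 < w" "\<tau> * (w * F (e0 + (1 / w) *\<^sub>R (y - e0))) \<le> 1"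
    by blast
  have "w \<le> v"
  proof (rule ccontr)
    assume "\<not> w \<le> v"
    moreover have "0 < F (e0 + (1 / v) *\<^sub>R (y - e0))"
      by (rule value_pos_if_perspective_pos[of \<tau> v]) (use ge in linarith)
    ultimately have "v * F (e0 + (1 / v) *\<^sub>R (y - e0)) + (w - v) * F e0 \<le> w * F (e0 + (1 / w) *\<^sub>R (y - e0))"
      "0 < (w - v) * F e0"
      using perspective_growth[OF v, of w y] center_pos by simp_all
    then have "v * F (e0 + (1 / v) *\<^sub>R (y - e0)) < w * F (e0 + (1 / w) *\<^sub>R (y - e0))" by linarith
    then have "\<tau> * (v * F (e0 + (1 / v) *\<^sub>R (y - e0))) < \<tau> * (w * F (e0 + (1 / w) *\<^sub>R (y - e0)))"
      using \<tau> by (rule mult_strict_left_mono)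
    then show False using ge w by linarith
  qed
  then show "x \<le> ennreal v" using w by (simp add: ennreal_leI)
qed

text \<open>The scaled perspective exceeds 1 just above level \<open>1 - k\<close>. Up to level 1,
  where it equals \<open>\<tau> * F y\<close>, it gains \<open>\<tau> * F e0\<close> per unit of
  level.\<close>

lemma radial_gain:
  assumes \<tau>: "0 < \<tau>" and le: "radial \<tau> y \<le> ennreal (1 - k)" and k: "0 < k" "k \<le> 1"
  shows "1 + k * (\<tau> * F e0) \<le> \<tau> * F y"
proof (rule field_le_mult_one_interval)
  \<comment> \<open>The factor \<open>t < 1\<close> moves the level strictly above
    \<open>1 - k\<close>, as \<open>radial_lessD\<close> requires.\<close>
  fix t :: real assume t: "0 < t" "t < 1"
  define v where "v = 1 - t * k"
  have "t * k < k" "0 < t * k" using t k by simp_all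
  then have v: "0 < v" "v \<le> 1" "1 - k < v" using k(2) unfolding v_def by linarith+
  have "ennreal (1 - k) < ennreal v" using v k by (simp add: ennreal_less_iff)
  then have 1: "1 < \<tau> * (v * F (e0 + (1 / v) *\<^sub>R (y - e0)))"
    using le by (intro radial_lessD \<tau>) (rule le_less_trans)
  then have "0 < F (e0 + (1 / v) *\<^sub>R (y - e0))"
    by (intro value_pos_if_perspective_pos[of \<tau> v]) linarith
  from perspective_growth[OF v(1,2) this] have "v * F (e0 + (1 / v) *\<^sub>R (y - e0)) + t * k * F e0 \<le> F y"
    by (simp add: v_def)
  then have "\<tau> * (v * F (e0 + (1 / v) *\<^sub>R (y - e0)) + t * k * F e0) \<le> \<tau> * F y"
    using \<tau> by (intro mult_left_mono) auto
  then show "t * (1 + k * (\<tau> * F e0)) \<le> \<tau> * F y" using 1 t by (simp add: algebra_simps)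
qed

text \<open>In the split of the scaled point of \<open>y + d\<close>, \<open>scaled_value_le\<close>
  keeps the fraction \<open>v / w\<close> of the value, so the perspective of \<open>y + d\<close>
  at \<open>w\<close> is at least that of \<open>y\<close> at \<open>v\<close>. A real bound
  \<open>r\<close> avoids subtraction in \<open>ennreal\<close>.\<close>

lemma radial_Lipschitz:
  assumes \<tau>: "0 < \<tau>" and r: "radial \<tau> y \<le> ennreal r" "0 \<le> r"
  shows "radial \<tau> (y + d) \<le> ennreal (r + norm d / R)"
proof (rule ennreal_le_epsilon)
  fix k :: real assume k: "0 < k"
  define v where "v = r + k"
  define w where "w = v + norm d / R"
  have v: "0 < v" using r k by (simp add: v_def)
  have w: "0 < w" "v \<le> w" using v R_pos by (auto simp: w_def add_pos_nonneg)
  have "ennreal r < ennreal v" using r k by (simp add: v_def ennreal_less_iff)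
  then have "1 < \<tau> * (v * F (e0 + (1 / v) *\<^sub>R (y - e0)))"
    using r(1) by (intro radial_lessD \<tau>) (rule le_less_trans)
  moreover have "v * F (e0 + (1 / v) *\<^sub>R (y - e0)) \<le> w * F (e0 + (1 / w) *\<^sub>R (y + d - e0))"
  proof -
    obtain u where u: "u \<in> cball e0 R" "e0 + (1 / w) *\<^sub>R (y + d - e0)
        = (v / w) *\<^sub>R (e0 + (1 / v) *\<^sub>R (y - e0)) + (1 - v / w) *\<^sub>R u"
      using scaled_point_split[OF v R_pos] unfolding w_def by blast
    have "v / w * F (e0 + (1 / v) *\<^sub>R (y - e0)) \<le> F (e0 + (1 / w) *\<^sub>R (y + d - e0))"
      unfolding u(2) using u(1) cball_R v w by (intro scaled_value_le) (auto simp: pos_def)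
    then show ?thesis using w by (simp add: field_simps)
  qed
  then have "\<tau> * (v * F (e0 + (1 / v) *\<^sub>R (y - e0))) \<le> \<tau> * (w * F (e0 + (1 / w) *\<^sub>R (y + d - e0)))"
    using \<tau> by (intro mult_left_mono) auto
  ultimately have "radial \<tau> (y + d) \<le> ennreal w"
    by (intro radial_le \<tau> w) linarith
  also have "ennreal w = ennreal (r + norm d / R) + ennreal k"
    using r k R_pos by (simp add: w_def v_def ennreal_plus[symmetric] add_ac del: ennreal_plus)
  finally show "radial \<tau> (y + d) \<le> ennreal (r + norm d / R) + ennreal k" .
qed

text \<open>
  Along the ray from \<open>e0\<close> through \<open>x\<close> the perspective is concave, nonnegative where the ray leaves
  the domain and equal to \<open>\<tau> * F x\<close> at \<open>1\<close>; the bound is where the chord reaches \<open>1\<close>.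
\<close>
lemma radial_le_gauge:
  assumes \<tau>: "0 < \<tau>" and x: "1 \<le> \<tau> * F x" and g: "minkowski_gauge pos e0 x < 1"
  shows "radial \<tau> x \<le> ennreal (1 - (1 - minkowski_gauge pos e0 x) * (1 - 1 / (\<tau> * F x)))"
proof (rule ennreal_le_epsilon)
  fix k :: real assume k: "0 < k"
  define g where "g = minkowski_gauge pos e0 x"
  define t where "t = 1 / (\<tau> * F x)"
  have t: "0 < t" "t \<le> 1" using x by (auto simp: t_def intro: order.strict_trans2[OF zero_less_one])
  have e0: "e0 \<in> interior pos" using cball_R R_pos mem_interior_cball by (auto simp: pos_def)
  obtain v' where v': "0 < v'" "v' < min (g + k) 1" "e0 + (1 / v') *\<^sub>R (x - e0) \<in> pos"
    using minkowski_gauge_approx[OF e0, of x "min (g + k) 1"] k g unfolding g_def by auto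
  \<comment> \<open>The chord from height 0 at \<open>v'\<close> to height
    \<open>\<tau> * F x\<close> at 1 reaches height 1 at this level.\<close>
  define v where "v = v' + (1 - v') * t"
  have v: "0 < v" "v \<le> 1" "v' < v"
  proof -
    have "0 < (1 - v') * t" "(1 - v') * t \<le> 1 - v'" using v' t by (simp_all add: mult_left_le)
    then show "0 < v" "v \<le> 1" "v' < v" using v'(1) unfolding v_def by linarith+
  qed
  \<comment> \<open>This weight puts the combination of \<open>x\<close> and the ray point at level
    \<open>v'\<close> on the ray at level \<open>v\<close>. Moreover \<open>v * a = t\<close>, so
    \<open>x\<close> alone contributes height 1.\<close>
  define a where "a = (v - v') / (v * (1 - v'))"
  have a1: "1 - a = v' * (1 - v) / (v * (1 - v'))"
    using v v' by (simp add: a_def field_simps)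
  have a: "0 \<le> a" "0 \<le> 1 - a" unfolding a1 using v v' by (auto simp: a_def)
  have "(1 - a) / v' = (1 - v) / (v * (1 - v'))" unfolding a1 using v' by simp
  then have "a + (1 - a) / v' = 1 / v"
    using v v' by (simp add: a_def add_divide_distrib[symmetric])
  moreover have "a *\<^sub>R x + (1 - a) *\<^sub>R (e0 + (1 / v') *\<^sub>R (x - e0)) = e0 + (a + (1 - a) / v') *\<^sub>R (x - e0)"
    by (simp add: algebra_simps)
  ultimately have "a * F x \<le> F (e0 + (1 / v) *\<^sub>R (x - e0))"
    using scaled_value_le[OF v'(3), of a x] a by simp
  then have "\<tau> * (v * (a * F x)) \<le> \<tau> * (v * F (e0 + (1 / v) *\<^sub>R (x - e0)))"
    using \<tau> v by (intro mult_left_mono) auto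
  moreover have "v * a = t" using v v' by (simp add: a_def) (simp add: v_def)
  then have "\<tau> * (v * (a * F x)) = 1" using t(1) by (simp add: t_def mult.assoc[symmetric]) (auto simp: mult_ac)
  ultimately have "radial \<tau> x \<le> ennreal v"
    by (intro radial_le \<tau> v) linarith
  also have "\<dots> \<le> ennreal (1 - (1 - g) * (1 - t) + k)"
  proof (rule ennreal_leI)
    have "v' * (1 - t) \<le> (g + k) * (1 - t)" using v' t by (intro mult_right_mono) auto
    moreover have "k * (1 - t) \<le> k" using k t by (simp add: mult_left_le)
    ultimately show "v \<le> 1 - (1 - g) * (1 - t) + k" by (simp add: v_def algebra_simps)
  qed
  also have "\<dots> = ennreal (1 - (1 - g) * (1 - t)) + ennreal k"
  proof -
    have "0 \<le> g" unfolding g_def by (rule minkowski_gauge_nonneg[OF e0])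
    then have "(1 - g) * (1 - t) \<le> 1 * 1" using t g unfolding g_def by (intro mult_mono) auto
    then show ?thesis using k by simp
  qed
  finally show "radial \<tau> x \<le> ennreal (1 - (1 - minkowski_gauge pos e0 x) * (1 - 1 / (\<tau> * F x))) + ennreal k"
    unfolding g_def t_def .
qed

section \<open>The radial objective: subgradients and the Slater point\<close>

lemma radial_objective_le_iff:
  assumes "0 \<le> t"
  shows "radial_objective (\<lambda>x. ennreal (F x)) e0 \<phi> \<tau> y \<le> ereal t \<longleftrightarrow> radial \<tau> y \<le> ennreal t \<and> \<phi> y \<le> t"
  using assms by (simp add: radial_objective_def less_eq_ennreal.rep_eq enn2ereal_ennreal)

lemma radial_objective_nonneg:
  "radial_objective (\<lambda>x. ennreal (F x)) e0 \<phi> \<tau> y \<le> ereal t \<Longrightarrow> 0 \<le> t"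
  unfolding radial_objective_def
  by (metis enn2ereal_nonneg ereal_less_eq(5) max.boundedE order_trans)

text \<open>Testing the subgradient inequality at \<open>y + g\<close> bounds
  \<open>(norm g)^2\<close> by the increase of the objective, which is at most
  \<open>L * norm g\<close> by the Lipschitz estimates.\<close>

lemma subgradient_bound:
  assumes \<tau>: "0 < \<tau>" and r: "0 < r" and \<phi>: "\<And>y d. \<phi> (y + d) \<le> \<phi> y + norm d / r"
    and g: "g \<in> subdifferential (radial_objective (\<lambda>x. ennreal (F x)) e0 \<phi> \<tau>) y"
  shows "norm g \<le> max (1 / R) (1 / r)"
proof -
  let ?h = "radial_objective (\<lambda>x. ennreal (F x)) e0 \<phi> \<tau>"
  define L where "L = max (1 / R) (1 / r)"
  have fin: "\<bar>?h y\<bar> \<noteq> \<infinity>" and "\<forall>x. ?h y + ereal (g \<bullet> (x - y)) \<le> ?h x"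
    using g by (auto simp: subdifferential_def)
  then have sub: "?h y + ereal (g \<bullet> (y + g - y)) \<le> ?h (y + g)" by blast
  obtain t where t: "?h y = ereal t" using fin by (cases "?h y") auto
  have t0: "0 \<le> t" using radial_objective_nonneg[of \<phi> \<tau> y t] t by simp
  have y: "radial \<tau> y \<le> ennreal t" "\<phi> y \<le> t" using radial_objective_le_iff[OF t0, of \<phi> \<tau> y] t by auto
  have L: "norm g / R \<le> L * norm g" "norm g / r \<le> L * norm g"
    using mult_right_mono[of "1 / R" L "norm g"] mult_right_mono[of "1 / r" L "norm g"] by (auto simp: L_def)
  have L0: "0 \<le> t + L * norm g" using t0 R_pos by (simp add: L_def le_max_iff_disj)
  have "radial \<tau> (y + g) \<le> ennreal (t + norm g / R)" by (rule radial_Lipschitz[OF \<tau> y(1) t0])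
  also have "\<dots> \<le> ennreal (t + L * norm g)" using L by (intro ennreal_leI) simp
  finally have "?h (y + g) \<le> ereal (t + L * norm g)"
    using \<phi>[of y g] y(2) L by (simp add: radial_objective_le_iff[OF L0])
  with sub have "?h y + ereal (g \<bullet> (y + g - y)) \<le> ereal (t + L * norm g)" by (rule order_trans)
  then have "norm g * norm g \<le> L * norm g" unfolding t by (simp add: power2_norm_eq_inner[symmetric] power2_eq_square)
  then show ?thesis unfolding L_def[symmetric]
    by (cases "g = 0") (use R_pos in \<open>auto simp: L_def le_max_iff_disj\<close>)
qed

text \<open>
  Moving from \<open>xs\<close> towards the Slater point \<open>xl\<close> lowers \<open>\<phi>\<close> at rate \<open>1 - \<phi> xl\<close> and raises the radial
  transform at rate at most \<open>diameter pos / R\<close>; the length of the move balances both effects.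
\<close>
lemma radial_objective_slater:
  assumes bdd: "bounded pos" and xs: "0 < F xs" and xl: "0 < F xl"
    and \<tau>: "0 < \<tau>" "1 \<le> \<tau> * F xs" and g: "minkowski_gauge pos e0 xs < 1"
    and \<phi>xl: "0 \<le> \<phi> xl" "\<phi> xl \<le> 1"
    and \<phi>: "\<And>l. 0 \<le> l \<Longrightarrow> l < 1 \<Longrightarrow> \<phi> (xs + l *\<^sub>R (xl - xs)) \<le> 1 - l * (1 - \<phi> xl)"
  defines "\<rho> \<equiv> R / (diameter pos + R)"
    and "s \<equiv> 1 - 1 / (\<tau> * F xs)"
  defines "l \<equiv> \<rho> * ((1 - minkowski_gauge pos e0 xs) * s)"
  shows "0 \<le> l" "l < 1"
    and "radial_objective (\<lambda>x. ennreal (F x)) e0 \<phi> \<tau> (xs + l *\<^sub>R (xl - xs)) \<le> ereal (1 - l * (1 - \<phi> xl))"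
proof -
  define a where "a = (1 - minkowski_gauge pos e0 xs) * s"
  have e0: "e0 \<in> interior pos" using cball_R R_pos mem_interior_cball by (auto simp: pos_def)
  have s: "0 \<le> s" "s \<le> 1" using \<tau>(2) by (auto simp: s_def divide_le_eq_1)
  have a: "0 \<le> a" "a \<le> 1"
    using s g minkowski_gauge_nonneg[OF e0, of xs] mult_mono[of "1 - minkowski_gauge pos e0 xs" 1 s 1]
    by (auto simp: a_def)
  have D: "norm (xl - xs) \<le> diameter pos"
    using diameter_bounded_bound[OF bdd mem_pos[OF xl] mem_pos[OF xs]] by (simp add: dist_norm)
  have D0: "0 < diameter pos"
  proof -
    have "R * F e0 \<le> diameter pos * F e0" by (rule center_value_ge[OF bdd center_pos])
    then show ?thesis using center_pos R_pos by simp
  qed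
  have DR: "0 < diameter pos + R" using R_pos D0 by simp
  have \<rho>: "0 < \<rho>" "\<rho> < 1" using R_pos D0 DR by (simp_all add: \<rho>_def)
  \<comment> \<open>This identity balances the move: it costs the radial transform at most
    \<open>a * (1 - \<rho>)\<close> of its decrease \<open>a\<close>, leaving exactly
    \<open>l = \<rho> * a\<close>.\<close>
  have "\<rho> * diameter pos / R = diameter pos / (diameter pos + R)" using R_pos by (simp add: \<rho>_def)
  also have "\<dots> = 1 - \<rho>" using DR by (simp add: \<rho>_def field_simps)
  finally have \<rho>D: "\<rho> * diameter pos / R = 1 - \<rho>" .
  have l: "l = \<rho> * a" by (simp add: l_def a_def)
  show l0: "0 \<le> l" using \<rho> a unfolding l by simp
  have "\<rho> * a \<le> \<rho> * 1" using \<rho> a by (intro mult_left_mono) auto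
  then show l1: "l < 1" using \<rho> unfolding l by linarith
  have "l * (1 - \<phi> xl) \<le> 1 * 1" using l0 l1 \<phi>xl by (intro mult_mono) auto
  then have B: "0 \<le> 1 - l * (1 - \<phi> xl)" by simp
  have "radial \<tau> (xs + l *\<^sub>R (xl - xs)) \<le> ennreal (1 - a + norm (l *\<^sub>R (xl - xs)) / R)"
    using radial_le_gauge[OF \<tau> g] a by (intro radial_Lipschitz \<tau>) (auto simp: a_def s_def)
  also have "\<dots> \<le> ennreal (1 - l * (1 - \<phi> xl))"
  proof (rule ennreal_leI)
    have "norm (l *\<^sub>R (xl - xs)) / R \<le> l * diameter pos / R"
      using D l0 R_pos by (intro divide_right_mono) (auto intro: mult_left_mono)
    also have "\<dots> = a * (1 - \<rho>)" unfolding l \<rho>D[symmetric] by simp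
    finally have "1 - a + norm (l *\<^sub>R (xl - xs)) / R \<le> 1 - l" by (simp add: l algebra_simps)
    also have "l * (1 - \<phi> xl) \<le> l" using l0 \<phi>xl by (simp add: mult_left_le)
    then have "1 - l \<le> 1 - l * (1 - \<phi> xl)" by simp
    finally show "1 - a + norm (l *\<^sub>R (xl - xs)) / R \<le> 1 - l * (1 - \<phi> xl)" .
  qed
  finally show "radial_objective (\<lambda>x. ennreal (F x)) e0 \<phi> \<tau> (xs + l *\<^sub>R (xl - xs)) \<le> ereal (1 - l * (1 - \<phi> xl))"
    using \<phi>[OF l0 l1] by (simp add: radial_objective_le_iff[OF B])
qed

end

text \<open>Finiteness makes \<open>enn2real\<close> faithful, since it would send an infinite value
  to 0.\<close>

lemma radial_function_enn2real:
  fixes f :: "'a::euclidean_space \<Rightarrow> ennreal"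
  assumes conc: "concave_enn f" and usc: "usc f" and fin: "\<And>x. f x < \<infinity>"
    and R: "0 < inner_radius e0 (closure (pos_dom f))"
  shows "radial_function (\<lambda>x. enn2real (f x)) e0 (inner_radius e0 (closure (pos_dom f)))"
proof
  have f: "f x = ennreal (enn2real (f x))" for x using fin[of x] by simp
  show "0 \<le> enn2real (f x)" for x by simp
  show "a * enn2real (f x) + (1 - a) * enn2real (f y) \<le> enn2real (f (a *\<^sub>R x + (1 - a) *\<^sub>R y))"
    if "0 < enn2real (f x)" "0 < enn2real (f y)" "0 \<le> a" "a \<le> 1" for x y a
  proof -
    have "ennreal (a * enn2real (f x) + (1 - a) * enn2real (f y)) \<le> f (a *\<^sub>R x + (1 - a) *\<^sub>R y)"
      using that f by (intro concave_ennD[OF conc]) auto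
    then show ?thesis by (subst (asm) f[of "a *\<^sub>R x + (1 - a) *\<^sub>R y"]) simp
  qed
  show "closed {x. t \<le> enn2real (f x)}" for t
  proof (cases "t \<le> 0")
    case True
    then have "{x. t \<le> enn2real (f x)} = UNIV" by (auto intro: order_trans)
    then show ?thesis by simp
  next
    case False
    have "t \<le> enn2real (f x) \<longleftrightarrow> ennreal t \<le> f x" for x
      by (subst (2) f) (use False in simp)
    then show ?thesis using closed_superlevel_if_usc[OF usc, of "ennreal t"] by simp
  qed
  show "0 < inner_radius e0 (closure (pos_dom f))" by (rule R)
  have "{x. 0 < enn2real (f x)} = pos_dom f"
    using fin by (auto simp: pos_dom_def enn2real_positive_iff)
  then show "cball e0 (inner_radius e0 (closure (pos_dom f))) \<subseteq> closure {x. 0 < enn2real (f x)}"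
    using cball_inner_radius_subset[OF closed_closure R] by simp
qed

section \<open>The Parallel MultiRadial Method\<close>

text \<open>
  The point \<open>ref \<tau>\<close> is the comparator of the subgradient method on \<open>\<Phi>\<^sub>\<tau>\<close>, and target accuracy \<open>\<delta>\<close>
  suffices for progress while the gap is at least \<open>\<kappa> * \<delta>\<close>. In the application
  \<open>\<kappa> = p_star / (c * \<rho>)\<close> and \<open>q = D0 / R0\<close>, so that \<open>q + 1 = 1 / \<rho>\<close>.
\<close>
locale multiradial =
  fixes f :: "'a::euclidean_space \<Rightarrow> ennreal" and F :: "'a \<Rightarrow> real" and e0 :: 'a
    and \<phi> :: "'a \<Rightarrow> real" and Q :: "'a set" and x0 :: 'a and b p \<kappa> q L D :: real
    and ref :: "real \<Rightarrow> 'a"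
  assumes f_eq: "f x = ennreal (F x)" and F_nonneg: "0 \<le> F x"
    and x0: "x0 \<in> Q" "0 < F x0" and F_le: "x \<in> Q \<Longrightarrow> F x \<le> p" and b: "2 \<le> b"
    and \<kappa>: "p \<le> \<kappa>" and L_pos: "0 < L"
    and subgradient_bound:
      "1 / p \<le> \<tau> \<Longrightarrow> g \<in> subdifferential (radial_objective f e0 \<phi> \<tau>) y \<Longrightarrow> norm g \<le> L"
    and gain: "0 < \<delta> \<Longrightarrow> 1 / p \<le> \<tau> \<Longrightarrow> radial_objective f e0 \<phi> \<tau> y \<le> ereal (1 - q * \<delta>) \<Longrightarrow>
      y \<in> Q \<and> 1 + \<delta> \<le> \<tau> * F y"
    and ref_objective: "0 < \<delta> \<Longrightarrow> 1 / p \<le> \<tau> \<Longrightarrow> \<tau> \<le> 1 / F x0 \<Longrightarrow> \<kappa> * \<delta> \<le> p - 1 / \<tau> \<Longrightarrow>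
      radial_objective f e0 \<phi> \<tau> (ref \<tau>) \<le> ereal (1 - (q + 1) * \<delta>)"
    and ref_dist: "y \<in> Q \<Longrightarrow> 0 < F y \<Longrightarrow> 1 / p \<le> \<tau> \<Longrightarrow> norm (y - ref \<tau>) \<le> D"
begin

section \<open>Iteration counts of the phases\<close>

text \<open>Each step without restart lowers a squared distance, initially at most
  \<open>D^2\<close>, by \<open>(\<delta> / L)^2\<close> with \<open>\<delta> = 1 / b ^ l\<close>.
  The summand 1 makes the total decrease exceed \<open>D^2\<close> strictly.\<close>

definition phase_length :: "nat \<Rightarrow> nat" where
  "phase_length l = nat \<lceil>(D\<^sup>2 * L\<^sup>2 + 1) * b ^ (2 * l)\<rceil>"

text \<open>A gap of \<open>\<kappa> * b * \<delta>\<close> is closed by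
  \<open>b * \<kappa> / F x0\<close> gains of \<open>\<delta> * F x0\<close>; the successor pays for
  the first block of a phase.\<close>

definition phase_restarts :: nat where
  "phase_restarts = Suc (nat \<lceil>b * \<kappa> / F x0\<rceil>)"

text \<open>The successor starts the count at iteration 1, as \<open>ybest 0\<close> is
  arbitrary.\<close>

definition phase_end :: "nat \<Rightarrow> nat" where
  "phase_end l = Suc (\<Sum>k\<in>{1..l}. phase_restarts * phase_length k)"

lemma p_pos: "0 < p"
  using x0 F_le by fastforce

lemma \<kappa>_pos: "0 < \<kappa>"
  using \<kappa> p_pos by simp

lemma phase_length_bound: "real (phase_length l) \<le> (D\<^sup>2 * L\<^sup>2 + 2) * b ^ (2 * l)"
proof -
  have 1: "1 \<le> b ^ (2 * l)" using b by (intro one_le_power) simp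
  then have "0 \<le> (D\<^sup>2 * L\<^sup>2 + 1) * b ^ (2 * l)" by simp
  then have "real (phase_length l) \<le> (D\<^sup>2 * L\<^sup>2 + 1) * b ^ (2 * l) + 1"
    unfolding phase_length_def by linarith
  then show ?thesis using 1 by (simp add: algebra_simps)
qed

text \<open>A geometric series of ratio \<open>b ^ 2\<close>, at least 4, is bounded by twice its
  last term.\<close>

lemma phase_end_bound:
  "real (phase_end l) \<le> 1 + 2 * (real phase_restarts * (D\<^sup>2 * L\<^sup>2 + 2)) * b ^ (2 * l)"
proof (induction l)
  case 0
  then show ?case by (simp add: phase_end_def)
next
  case (Suc l)
  define C where "C = real phase_restarts * (D\<^sup>2 * L\<^sup>2 + 2)"
  have C: "0 \<le> C" by (simp add: C_def)
  have bb: "4 \<le> b ^ 2" using b power_mono[of 2 b 2] by simp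
  have "real (phase_end (Suc l)) = real (phase_end l) + real phase_restarts * real (phase_length (Suc l))"
    by (simp add: phase_end_def)
  also have "\<dots> \<le> (1 + 2 * C * b ^ (2 * l)) + C * b ^ (2 * Suc l)"
    using Suc mult_left_mono[OF phase_length_bound[of "Suc l"], of "real phase_restarts"]
    unfolding C_def by (simp add: mult.assoc)
  also have "2 * C * b ^ (2 * l) \<le> C * b ^ (2 * Suc l)"
  proof -
    have "(C * b ^ (2 * l)) * 2 \<le> (C * b ^ (2 * l)) * b ^ 2"
      using bb C b by (intro mult_left_mono) auto
    then show ?thesis by (simp add: power_add power2_eq_square mult_ac)
  qed
  finally have "real (phase_end (Suc l)) \<le> 1 + 2 * (C * b ^ (2 * Suc l))" by linarith
  then show ?case unfolding C_def by (simp only: mult.assoc)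
qed

text \<open>Minimality of a positive \<open>l\<close> gives
  \<open>\<epsilon> * b ^ (l - 1) < \<kappa>\<close>, so \<open>b ^ (2 * l)\<close> is at most
  \<open>(b * \<kappa> / \<epsilon>)^2\<close>. The summand 1 in the constant covers
  \<open>l = 0\<close>.\<close>

lemma phase_end_bigo:
  "(\<lambda>\<epsilon>. real (phase_end (LEAST l. \<kappa> \<le> \<epsilon> * b ^ l))) \<in> O[at_right 0](\<lambda>\<epsilon>. 1 / \<epsilon>\<^sup>2)"
proof -
  define C where "C = 2 * (real phase_restarts * (D\<^sup>2 * L\<^sup>2 + 2))"
  have C: "0 \<le> C" by (simp add: C_def)
  have "real (phase_end (LEAST l. \<kappa> \<le> \<epsilon> * b ^ l)) \<le> (1 + C * (1 + (b * \<kappa>)\<^sup>2)) * (1 / \<epsilon>\<^sup>2)"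
    if \<epsilon>: "0 < \<epsilon>" "\<epsilon> < 1" for \<epsilon>
  proof -
    define l where "l = (LEAST l. \<kappa> \<le> \<epsilon> * b ^ l)"
    have e1: "1 \<le> 1 / \<epsilon>\<^sup>2" using \<epsilon> by (simp add: power_le_one)
    have "b ^ (2 * l) \<le> (1 + (b * \<kappa>)\<^sup>2) * (1 / \<epsilon>\<^sup>2)"
    proof (cases l)
      case 0
      have "1 * 1 \<le> (1 + (b * \<kappa>)\<^sup>2) * (1 / \<epsilon>\<^sup>2)" using e1 by (intro mult_mono) auto
      then show ?thesis using 0 by simp
    next
      case (Suc k)
      then have "\<not> \<kappa> \<le> \<epsilon> * b ^ k"
        using not_less_Least[of k "\<lambda>l. \<kappa> \<le> \<epsilon> * b ^ l"] unfolding l_def by simp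
      then have "b * (\<epsilon> * b ^ k) \<le> b * \<kappa>" using b by (intro mult_left_mono) auto
      then have "b ^ l \<le> b * \<kappa> / \<epsilon>" using \<epsilon> Suc by (simp add: field_simps)
      then have "(b ^ l)\<^sup>2 \<le> (b * \<kappa> / \<epsilon>)\<^sup>2" using b by (intro power_mono) auto
      also have "\<dots> = (b * \<kappa>)\<^sup>2 * (1 / \<epsilon>\<^sup>2)" by (simp add: power_divide)
      also have "\<dots> \<le> (1 + (b * \<kappa>)\<^sup>2) * (1 / \<epsilon>\<^sup>2)" by (intro mult_right_mono) auto
      finally show ?thesis by (simp add: power_mult[symmetric] mult.commute)
    qed
    from mult_left_mono[OF this C] phase_end_bound[of l]
    have "real (phase_end l) \<le> 1 + C * ((1 + (b * \<kappa>)\<^sup>2) * (1 / \<epsilon>\<^sup>2))"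
      unfolding C_def by linarith
    also have "\<dots> \<le> (1 + C * (1 + (b * \<kappa>)\<^sup>2)) * (1 / \<epsilon>\<^sup>2)"
      unfolding distrib_right[of 1] mult_1_left mult.assoc using e1 by (rule add_right_mono)
    finally show ?thesis by (simp add: l_def)
  qed
  then have "\<forall>\<^sub>F \<epsilon> in at_right 0. norm (real (phase_end (LEAST l. \<kappa> \<le> \<epsilon> * b ^ l)))
      \<le> (1 + C * (1 + (b * \<kappa>)\<^sup>2)) * norm (1 / \<epsilon>\<^sup>2)"
    unfolding eventually_at_right_field by (intro exI[of _ 1]) auto
  then show ?thesis by (rule bigoI)
qed

end

locale multiradial_run = multiradial +
  fixes N :: nat and z y :: "nat \<Rightarrow> nat \<Rightarrow> 'a" and \<tau> :: "nat \<Rightarrow> nat \<Rightarrow> real" and ybest :: "nat \<Rightarrow> 'a"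
  assumes run: "parallel_multiradial subgrad_step f e0 \<phi> Q x0 b N z y \<tau> ybest" and N_pos: "0 < N"
begin

section \<open>Invariants of a run\<close>

definition W :: "nat \<Rightarrow> 'a set" where
  "W i = {z l i' | l i'. l \<in> {1..N} \<and> i' \<le> i} \<inter> Q"

abbreviation \<delta> :: "nat \<Rightarrow> real" where
  "\<delta> l \<equiv> 1 / b ^ l"

lemma \<delta>_pos: "0 < \<delta> l"
  using b by simp

lemma init:
  assumes "l \<in> {1..N}"
  shows "z l 0 = x0" "y l 0 = x0" "\<tau> l 0 = 1 / F x0"
  using run assms F_nonneg unfolding parallel_multiradial_def by (auto simp: f_eq)

lemma step:
  assumes "l \<in> {1..N}"
  shows "subgrad_step (\<delta> l) (radial_objective f e0 \<phi> (\<tau> l i)) (y l i) (z l (Suc i))"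
  using run assms unfolding parallel_multiradial_def by blast

lemma ybest:
  shows "ybest (Suc i) \<in> W (Suc i)" and "w \<in> W (Suc i) \<Longrightarrow> F w \<le> F (ybest (Suc i))"
    and "l \<in> {1..N} \<Longrightarrow> if 1 / F (ybest (Suc i)) \<le> 1 / (1 + \<delta> l) * \<tau> l i
       then \<tau> l (Suc i) = 1 / F (ybest (Suc i)) \<and> y l (Suc i) = ybest (Suc i)
       else \<tau> l (Suc i) = \<tau> l i \<and> y l (Suc i) = z l (Suc i)"
  using run F_nonneg unfolding parallel_multiradial_def Let_def W_def
  by (simp_all add: f_eq ennreal_le_iff)

definition restart :: "nat \<Rightarrow> nat \<Rightarrow> bool" where
  "restart l i \<longleftrightarrow> 1 / F (ybest (Suc i)) \<le> 1 / (1 + \<delta> l) * \<tau> l i"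

lemma restartD:
  assumes "l \<in> {1..N}" "restart l i"
  shows "\<tau> l (Suc i) = 1 / F (ybest (Suc i))" "y l (Suc i) = ybest (Suc i)"
  using ybest(3)[OF assms(1), of i] assms(2) by (simp_all add: restart_def)

lemma not_restartD:
  assumes "l \<in> {1..N}" "\<not> restart l i"
  shows "\<tau> l (Suc i) = \<tau> l i" "y l (Suc i) = z l (Suc i)"
  using ybest(3)[OF assms(1), of i] assms(2) by (simp_all add: restart_def)

lemma W_mono: "i \<le> j \<Longrightarrow> W i \<subseteq> W j"
  unfolding W_def by force

lemma W_Q: "w \<in> W i \<Longrightarrow> w \<in> Q"
  by (simp add: W_def)

lemma x0_W: "x0 \<in> W i"
proof -
  have "(1::nat) \<in> {1..N}" using N_pos by simp
  then show ?thesis using init(1)[of 1] x0(1) unfolding W_def by force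
qed

lemma ybest_ge_x0: "F x0 \<le> F (ybest (Suc i))"
  using ybest(2) x0_W by blast

lemma ybest_mono:
  assumes "1 \<le> i" "i \<le> j"
  shows "F (ybest i) \<le> F (ybest j)"
proof -
  obtain i' j' where "i = Suc i'" "j = Suc j'" using assms by (metis Suc_le_D One_nat_def le_trans)
  then show ?thesis using ybest(1)[of i'] ybest(2)[of _ j'] W_mono[OF assms(2)] by blast
qed

text \<open>The parameter changes only at restarts, to the reciprocal of a best value. Hence
  \<open>1 / \<tau> l i\<close> is always the value at a feasible iterate already produced, from
  which \<open>\<tau>_bounds\<close> follows.\<close>

lemma \<tau>_eq:
  assumes l: "l \<in> {1..N}"
  shows "\<exists>w\<in>W i. F x0 \<le> F w \<and> \<tau> l i = 1 / F w"
proof (induction i)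
  case 0
  then show ?case using x0_W init(3)[OF l] by blast
next
  case (Suc i)
  show ?case
  proof (cases "restart l i")
    case True
    then show ?thesis using restartD[OF l] ybest(1) ybest_ge_x0 by blast
  next
    case False
    then show ?thesis using Suc not_restartD[OF l] W_mono[of i "Suc i"] by auto
  qed
qed

lemma \<tau>_bounds:
  assumes l: "l \<in> {1..N}"
  shows "0 < \<tau> l i" "F x0 \<le> 1 / \<tau> l i" "1 / p \<le> \<tau> l i" "\<tau> l i \<le> 1 / F x0"
    "1 \<le> i \<Longrightarrow> 1 / \<tau> l i \<le> F (ybest i)" "1 / \<tau> l i \<le> F (ybest (Suc i))"
proof -
  obtain w where w: "w \<in> W i" "F x0 \<le> F w" "\<tau> l i = 1 / F w" using \<tau>_eq[OF l] by blast
  have pos: "0 < F w" using w x0 by linarith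
  have "F w \<le> p" using F_le W_Q w by blast
  then show "0 < \<tau> l i" "F x0 \<le> 1 / \<tau> l i" "1 / p \<le> \<tau> l i" "\<tau> l i \<le> 1 / F x0"
    using pos w x0 by (simp_all add: frac_le)
  show "1 / \<tau> l i \<le> F (ybest i)" if "1 \<le> i"
    using ybest(2)[of w "i - 1"] that w by simp
  show "1 / \<tau> l i \<le> F (ybest (Suc i))"
    using ybest(2)[of w i] w W_mono[of i "Suc i"] by auto
qed

lemma restart_iff:
  assumes l: "l \<in> {1..N}"
  shows "restart l i \<longleftrightarrow> (1 + \<delta> l) * (1 / \<tau> l i) \<le> F (ybest (Suc i))"
proof -
  have "0 < F (ybest (Suc i))" using ybest_ge_x0[of i] x0 by linarith
  moreover have "0 < 1 + \<delta> l" using \<delta>_pos[of l] by linarith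
  ultimately show ?thesis unfolding restart_def using \<tau>_bounds(1)[OF l, of i]
    by (simp add: pos_divide_le_eq pos_le_divide_eq mult.commute)
qed

text \<open>The second claim holds in both cases: after a restart \<open>1 / \<tau>\<close> equals
  the best value, and otherwise the restart test has just failed.\<close>

lemma inverse_\<tau>_step:
  assumes l: "l \<in> {1..N}"
  shows "1 / \<tau> l i \<le> 1 / \<tau> l (Suc i)" "F (ybest (Suc i)) \<le> (1 + \<delta> l) * (1 / \<tau> l (Suc i))"
    "restart l i \<Longrightarrow> (1 + \<delta> l) * (1 / \<tau> l i) \<le> 1 / \<tau> l (Suc i)"
proof -
  have 1: "1 * (1 / \<tau> l j) \<le> (1 + \<delta> l) * (1 / \<tau> l j)" for j
    using \<delta>_pos[of l] \<tau>_bounds(1)[OF l, of j] by (intro mult_right_mono) auto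
  show "(1 + \<delta> l) * (1 / \<tau> l i) \<le> 1 / \<tau> l (Suc i)" if "restart l i"
    using that restartD[OF l] restart_iff[OF l] by simp
  then show "1 / \<tau> l i \<le> 1 / \<tau> l (Suc i)"
    using 1[of i] not_restartD[OF l, of i] by (cases "restart l i") auto
  show "F (ybest (Suc i)) \<le> (1 + \<delta> l) * (1 / \<tau> l (Suc i))"
    using 1[of "Suc i"] restartD[OF l, of i] not_restartD[OF l, of i] restart_iff[OF l, of i]
    by (cases "restart l i") auto
qed

lemma inverse_\<tau>_mono:
  assumes "l \<in> {1..N}" "i \<le> j"
  shows "1 / \<tau> l i \<le> 1 / \<tau> l j"
  using assms(2) by (induction j rule: dec_induct) (use inverse_\<tau>_step(1)[OF assms(1)] order_trans in auto)

section \<open>Distance to the reference point and restarts\<close>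

lemma y_W:
  assumes l: "l \<in> {1..N}" and "y l i \<in> Q"
  shows "y l i \<in> W (Suc i)"
proof (cases i)
  case 0
  then show ?thesis using init(2)[OF l] x0_W by simp
next
  case (Suc j)
  show ?thesis
  proof (cases "restart l j")
    case True
    then show ?thesis using restartD[OF l] ybest(1)[of j] Suc W_mono[of i "Suc i"] by auto
  next
    case False
    then show ?thesis using not_restartD[OF l] Suc assms unfolding W_def by fastforce
  qed
qed

text \<open>
  Without a restart the current iterate is not yet good enough to trigger one, so its objective
  exceeds that of the reference point by more than \<open>\<delta> l\<close>, and the step moves towards that point.
\<close>
lemma descent:
  assumes l: "l \<in> {1..N}" and nr: "\<not> restart l i" and gap: "\<kappa> * \<delta> l < p - F (ybest (Suc i))"
  shows "(norm (y l (Suc i) - ref (\<tau> l (Suc i))))\<^sup>2 \<le> (norm (y l i - ref (\<tau> l i)))\<^sup>2 - (\<delta> l / L)\<^sup>2"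
proof -
  let ?h = "radial_objective f e0 \<phi> (\<tau> l i)" and ?x = "ref (\<tau> l i)"
  have d: "0 < \<delta> l" by (rule \<delta>_pos)
  note \<tau> = \<tau>_bounds[OF l, of i]
  obtain g where g: "g \<in> subdifferential ?h (y l i)"
    and z: "z l (Suc i) = y l i - (\<delta> l / (norm g)\<^sup>2) *\<^sub>R g"
    using step[OF l, of i] unfolding subgrad_step_def by blast
  have gL: "norm g \<le> L" using subgradient_bound[OF \<tau>(3) g] .
  obtain r where r: "?h (y l i) = ereal r"
    using g by (cases "?h (y l i)") (auto simp: subdifferential_def)
  have "1 - q * \<delta> l < r"
  proof (rule ccontr)
    assume "\<not> ?thesis"
    then have "?h (y l i) \<le> ereal (1 - q * \<delta> l)" using r by simp
    from gain[OF d \<tau>(3) this] have "y l i \<in> Q" "1 + \<delta> l \<le> \<tau> l i * F (y l i)" by auto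
    moreover from this have "F (y l i) \<le> F (ybest (Suc i))" using ybest(2) y_W[OF l] by blast
    ultimately have "(1 + \<delta> l) * (1 / \<tau> l i) \<le> F (ybest (Suc i))"
      using \<tau>(1) by (simp add: pos_divide_le_eq mult.commute) (meson mult_left_mono less_imp_le order_trans)
    then show False using nr restart_iff[OF l] by simp
  qed
  \<comment> \<open>\<open>1 / \<tau> l i\<close> is at most the best value, so the assumed gap also
    bounds \<open>p - 1 / \<tau> l i\<close> from below.\<close>
  moreover have "?h ?x \<le> ereal (1 - (q + 1) * \<delta> l)"
    using gap \<tau> by (intro ref_objective d) auto
  moreover have "ereal r + ereal (g \<bullet> (?x - y l i)) \<le> ?h ?x"
    using g r by (auto simp: subdifferential_def)
  ultimately have "r + g \<bullet> (?x - y l i) \<le> 1 - (q + 1) * \<delta> l" "1 - q * \<delta> l < r"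
    by (metis ereal_less_eq(3) order_trans plus_ereal.simps(1))+
  then have gd: "\<delta> l < g \<bullet> (y l i - ?x)" by (simp add: algebra_simps add_divide_distrib)
  then have g0: "g \<noteq> 0" using d inner_zero_left[of "y l i - ?x"] by (metis less_asym)
  define s where "s = \<delta> l / (norm g)\<^sup>2"
  have s: "0 < s" using d g0 by (simp add: s_def)
  have "(norm (z l (Suc i) - ?x))\<^sup>2 = (norm (y l i - ?x))\<^sup>2 - 2 * s * (g \<bullet> (y l i - ?x)) + s\<^sup>2 * (norm g)\<^sup>2"
  proof -
    have "z l (Suc i) - ?x = (y l i - ?x) - s *\<^sub>R g" unfolding z s_def[symmetric] by simp
    moreover have "(norm (v - s *\<^sub>R g))\<^sup>2 = (norm v)\<^sup>2 - 2 * s * (g \<bullet> v) + s\<^sup>2 * (norm g)\<^sup>2" for v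
      unfolding power2_norm_eq_inner
      by (simp add: inner_diff_left inner_diff_right inner_commute power2_eq_square algebra_simps)
    ultimately show ?thesis by metis
  qed
  also have "s\<^sup>2 * (norm g)\<^sup>2 = s * \<delta> l" using g0 by (simp add: s_def power2_eq_square)
  \<comment> \<open>The inner product exceeds \<open>\<delta> l\<close>, so the cross term is at
    least twice the quadratic term \<open>s * \<delta> l\<close>.\<close>
  also have "(norm (y l i - ?x))\<^sup>2 - 2 * s * (g \<bullet> (y l i - ?x)) + s * \<delta> l \<le> (norm (y l i - ?x))\<^sup>2 - s * \<delta> l"
    using mult_left_mono[of "\<delta> l" "g \<bullet> (y l i - ?x)" s] gd s by simp
  finally have "(norm (z l (Suc i) - ?x))\<^sup>2 \<le> (norm (y l i - ?x))\<^sup>2 - s * \<delta> l" .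
  moreover have "(\<delta> l / L)\<^sup>2 \<le> s * \<delta> l"
  proof -
    have "(norm g)\<^sup>2 \<le> L\<^sup>2" using gL by (intro power_mono) auto
    then have "(\<delta> l)\<^sup>2 / L\<^sup>2 \<le> (\<delta> l)\<^sup>2 / (norm g)\<^sup>2" using g0 L_pos by (intro divide_left_mono) auto
    then show ?thesis by (simp add: s_def power_divide power_mult_distrib power2_eq_square mult_ac)
  qed
  ultimately show ?thesis using not_restartD[OF l nr] by simp
qed

text \<open>A restart changes the reference point together with the iterate, which becomes a
  feasible point of positive value, so \<open>ref_dist\<close> applies afresh; between restarts
  \<open>descent\<close> keeps the bound.\<close>

lemma ref_dist_invariant:
  assumes l: "l \<in> {1..N}" and gap: "\<And>j. j < i \<Longrightarrow> \<kappa> * \<delta> l < p - F (ybest (Suc j))"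
  shows "(norm (y l i - ref (\<tau> l i)))\<^sup>2 \<le> D\<^sup>2"
  using gap
proof (induction i)
  case 0
  have "norm (x0 - ref (\<tau> l 0)) \<le> D" using ref_dist x0 \<tau>_bounds(3)[OF l] by blast
  then show ?case using init[OF l] by (simp add: power_mono)
next
  case (Suc i)
  show ?case
  proof (cases "restart l i")
    case True
    have "norm (ybest (Suc i) - ref (\<tau> l (Suc i))) \<le> D"
      using ybest(1)[of i] W_Q ybest_ge_x0[of i] x0(2) \<tau>_bounds(3)[OF l] by (intro ref_dist) auto
    then show ?thesis using restartD[OF l True] by (simp add: power_mono)
  next
    case False
    have "(norm (y l i - ref (\<tau> l i)))\<^sup>2 \<le> D\<^sup>2" using Suc by simp
    then show ?thesis using descent[OF l False Suc.prems[of i]] zero_le_power2[of "\<delta> l / L"] by linarith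
  qed
qed

lemma restart_within:
  assumes l: "l \<in> {1..N}"
    and gap: "\<And>j. j < i + phase_length l \<Longrightarrow> \<kappa> * \<delta> l < p - F (ybest (Suc j))"
  shows "\<exists>j. i \<le> j \<and> j < i + phase_length l \<and> restart l j"
proof (rule ccontr)
  assume *: "\<not> ?thesis"
  define V where "V j = (norm (y l j - ref (\<tau> l j)))\<^sup>2" for j
  have "V (i + k) \<le> D\<^sup>2 - real k * (\<delta> l / L)\<^sup>2" if "k \<le> phase_length l" for k
    using that
  proof (induction k)
    case 0
    then show ?case using ref_dist_invariant[OF l, of i] gap by (simp add: V_def)
  next
    case (Suc k)
    have "V (Suc (i + k)) \<le> V (i + k) - (\<delta> l / L)\<^sup>2"
      unfolding V_def using * gap Suc.prems by (intro descent l) auto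
    then show ?case using Suc by (simp add: algebra_simps)
  qed
  from this[OF order_refl] have le: "real (phase_length l) * (\<delta> l / L)\<^sup>2 \<le> D\<^sup>2"
    using zero_le_power2[of "norm (y l (i + phase_length l) - ref (\<tau> l (i + phase_length l)))"]
    unfolding V_def by linarith
  \<comment> \<open>With this many steps the total decrease is at least
    \<open>D^2 + 1 / L^2\<close>.\<close>
  have "(D\<^sup>2 * L\<^sup>2 + 1) * b ^ (2 * l) \<le> real (phase_length l)"
    unfolding phase_length_def by linarith
  then have "(D\<^sup>2 * L\<^sup>2 + 1) * b ^ (2 * l) * (\<delta> l / L)\<^sup>2 \<le> D\<^sup>2"
    using le mult_right_mono[of _ "real (phase_length l)" "(\<delta> l / L)\<^sup>2"] by (meson order_trans zero_le_power2)
  moreover have "b ^ (2 * l) * (\<delta> l / L)\<^sup>2 = 1 / L\<^sup>2"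
  proof -
    have "b ^ (2 * l) = (b ^ l)\<^sup>2" by (simp add: power_mult[symmetric] mult.commute)
    then show ?thesis using b by (simp add: power_divide power_mult_distrib)
  qed
  ultimately have "(D\<^sup>2 * L\<^sup>2 + 1) * (1 / L\<^sup>2) \<le> D\<^sup>2" by (metis mult.assoc)
  then show False using L_pos by (simp add: field_simps)
qed

section \<open>Phases and convergence\<close>

lemma block_growth:
  assumes l: "l \<in> {1..N}"
    and gap: "\<And>j. j < i + phase_length l \<Longrightarrow> \<kappa> * \<delta> l < p - F (ybest (Suc j))"
  shows "(1 + \<delta> l) * (1 / \<tau> l i) \<le> 1 / \<tau> l (i + phase_length l)"
proof -
  obtain j where j: "i \<le> j" "j < i + phase_length l" "restart l j"
    using restart_within[OF assms] by blast
  have "(1 + \<delta> l) * (1 / \<tau> l i) \<le> (1 + \<delta> l) * (1 / \<tau> l j)"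
    using inverse_\<tau>_mono[OF l j(1)] \<delta>_pos[of l] by (intro mult_left_mono) auto
  also have "\<dots> \<le> 1 / \<tau> l (Suc j)" using inverse_\<tau>_step(3)[OF l j(3)] .
  also have "\<dots> \<le> 1 / \<tau> l (i + phase_length l)" using j by (intro inverse_\<tau>_mono l) auto
  finally show ?thesis .
qed

text \<open>
  The first block of a phase brings \<open>1 / \<tau> l\<close> up to the value of the best iterate at its start,
  each later one adds at least \<open>\<delta> l * F x0\<close>.
\<close>
lemma phase:
  assumes l: "l \<in> {1..N}" and a: "1 \<le> a" and start: "p - F (ybest a) \<le> \<kappa> * b * \<delta> l"
  shows "p - F (ybest (a + phase_restarts * phase_length l)) \<le> \<kappa> * \<delta> l"
proof (rule ccontr)
  let ?T = "phase_length l"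
  assume *: "\<not> ?thesis"
  \<comment> \<open>Best values never decrease, so a large gap at the end of the phase was present
    throughout it.\<close>
  have gap: "\<kappa> * \<delta> l < p - F (ybest (Suc j))" if "j < a + phase_restarts * ?T" for j
    using * ybest_mono[of "Suc j" "a + phase_restarts * ?T"] that by simp
  have "F (ybest a) + real k * (\<delta> l * F x0) \<le> 1 / \<tau> l (a + Suc k * ?T)"
    if "Suc k \<le> phase_restarts" for k
    using that
  proof (induction k)
    case 0
    have "?T \<le> phase_restarts * ?T" by (simp add: phase_restarts_def)
    then have "(1 + \<delta> l) * (1 / \<tau> l a) \<le> 1 / \<tau> l (a + ?T)"
      by (intro block_growth l gap) linarith
    moreover have "F (ybest a) \<le> (1 + \<delta> l) * (1 / \<tau> l a)"
      using inverse_\<tau>_step(2)[OF l, of "a - 1"] a by simp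
    ultimately show ?case by simp
  next
    case (Suc k)
    let ?i = "a + Suc k * ?T"
    have "Suc (Suc k) * ?T \<le> phase_restarts * ?T" using Suc.prems by (rule mult_le_mono1)
    then have "(1 + \<delta> l) * (1 / \<tau> l ?i) \<le> 1 / \<tau> l (?i + ?T)"
      by (intro block_growth l gap) auto
    moreover have "\<delta> l * F x0 \<le> \<delta> l * (1 / \<tau> l ?i)"
      using \<tau>_bounds(2)[OF l, of ?i] \<delta>_pos[of l] by (intro mult_left_mono) auto
    ultimately have "1 / \<tau> l ?i + \<delta> l * F x0 \<le> 1 / \<tau> l (?i + ?T)"
      by (simp only: distrib_right mult_1_left)
    moreover have "?i + ?T = a + Suc (Suc k) * ?T" by simp
    ultimately have "1 / \<tau> l ?i + \<delta> l * F x0 \<le> 1 / \<tau> l (a + Suc (Suc k) * ?T)" by metis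
    moreover have "F (ybest a) + real k * (\<delta> l * F x0) \<le> 1 / \<tau> l ?i" using Suc by simp
    moreover have "real (Suc k) * (\<delta> l * F x0) = real k * (\<delta> l * F x0) + \<delta> l * F x0"
      unfolding of_nat_Suc distrib_right by simp
    ultimately show ?case by linarith
  qed
  note growth = this
  \<comment> \<open>\<open>M\<close> counts the blocks after the first. Their gains cover the whole
    initial gap \<open>\<kappa> * b * \<delta> l\<close>, so the final gap would not be
    positive.\<close>
  define M where "M = nat \<lceil>b * \<kappa> / F x0\<rceil>"
  have M: "phase_restarts = Suc M" by (simp add: M_def phase_restarts_def)
  have "F (ybest a) + real M * (\<delta> l * F x0) \<le> F (ybest (a + phase_restarts * ?T))"
    using growth[of M] \<tau>_bounds(5)[OF l, of "a + phase_restarts * ?T"] a unfolding M by linarith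
  moreover have "b * \<kappa> \<le> real M * F x0"
  proof -
    have "b * \<kappa> / F x0 \<le> real M" unfolding M_def by linarith
    then show ?thesis using x0 by (simp add: pos_divide_le_eq)
  qed
  then have "b * \<kappa> * \<delta> l \<le> real M * F x0 * \<delta> l"
    using \<delta>_pos[of l] by (intro mult_right_mono) auto
  then have "\<kappa> * b * \<delta> l \<le> real M * (\<delta> l * F x0)" by (simp add: mult_ac)
  moreover have "0 < \<kappa> * \<delta> l" using \<kappa>_pos \<delta>_pos[of l] by (rule mult_pos_pos)
  ultimately show False using * start by linarith
qed

text \<open>Phase \<open>Suc l\<close> relies on instance \<open>Suc l\<close> alone and starts from
  the gap left by phase \<open>l\<close>. For \<open>l = 0\<close> the bound is
  \<open>p \<le> \<kappa>\<close>, without any instance.\<close>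

lemma gap_at_phase_end:
  assumes "l \<le> N"
  shows "p - F (ybest (phase_end l)) \<le> \<kappa> * \<delta> l"
  using assms
proof (induction l)
  case 0
  then show ?case using \<kappa> F_nonneg[of "ybest (phase_end 0)"] by simp
next
  case (Suc l)
  have "\<kappa> * b * \<delta> (Suc l) = \<kappa> * \<delta> l" using b by simp
  then have "p - F (ybest (phase_end l + phase_restarts * phase_length (Suc l))) \<le> \<kappa> * \<delta> (Suc l)"
    using Suc by (intro phase) (auto simp: phase_end_def)
  then show ?case by (simp add: phase_end_def)
qed

text \<open>The bound on \<open>N\<close> ensures that the least \<open>l\<close> with
  \<open>\<kappa> \<le> \<epsilon> * b ^ l\<close> is at most \<open>N\<close>; the iteration count
  itself depends only on this \<open>l\<close>.\<close>

lemma convergence: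
  assumes \<epsilon>: "0 < \<epsilon>" and N: "log b (b * \<kappa> / \<epsilon>) \<le> real N"
  shows "\<exists>i\<ge>1. i \<le> phase_end (LEAST l. \<kappa> \<le> \<epsilon> * b ^ l) \<and> ybest i \<in> Q \<and> p - F (ybest i) \<le> \<epsilon>"
proof -
  define l where "l = (LEAST l. \<kappa> \<le> \<epsilon> * b ^ l)"
  have "b * \<kappa> / \<epsilon> \<le> b powr real N"
    using N b \<epsilon> \<kappa>_pos by (subst (asm) log_le_iff) auto
  then have "b * \<kappa> \<le> \<epsilon> * b ^ N" using b \<epsilon> by (simp add: powr_realpow pos_divide_le_eq mult.commute)
  moreover have "1 * \<kappa> \<le> b * \<kappa>" using b \<kappa>_pos by (intro mult_right_mono) auto
  ultimately have *: "\<kappa> \<le> \<epsilon> * b ^ N" by simp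
  have l: "l \<le> N" "\<kappa> \<le> \<epsilon> * b ^ l"
    unfolding l_def using Least_le[of "\<lambda>l. \<kappa> \<le> \<epsilon> * b ^ l", OF *] LeastI[of "\<lambda>l. \<kappa> \<le> \<epsilon> * b ^ l", OF *] by auto
  have "\<kappa> * \<delta> l \<le> \<epsilon>" using l(2) b by (simp add: pos_divide_le_eq)
  then have "p - F (ybest (phase_end l)) \<le> \<epsilon>" using gap_at_phase_end[OF l(1)] by linarith
  moreover have "ybest (phase_end l) \<in> Q" unfolding phase_end_def using ybest(1) W_Q by blast
  moreover have "1 \<le> phase_end l" by (simp add: phase_end_def)
  ultimately show ?thesis unfolding l_def by blast
qed

end

section \<open>Application to the problem data\<close>

theorem corollary4p1:
  fixes f :: "'a::euclidean_space \<Rightarrow> ennreal"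
    and S :: "nat \<Rightarrow> 'a set" and e :: "nat \<Rightarrow> 'a" and m :: nat
    and e0 x_star x_SL x0 :: 'a and b :: real
  defines "S0 \<equiv> closure (pos_dom f)"
  defines "D0 \<equiv> diameter S0"
  defines "R0 \<equiv> inner_radius e0 S0"
  defines "Q \<equiv> (\<Inter>j\<in>{1..m}. S j)"
  defines "\<phi> \<equiv> max_gauge m S e"
  defines "p_star \<equiv> (SUP x\<in>Q. f x)"
  defines "\<eta> \<equiv> (1 - minkowski_gauge S0 e0 x_star) * (1 - \<phi> x_SL)"
  defines "\<tau>0 \<equiv> 1 / enn2real (f x0)"
  defines "\<rho> \<equiv> R0 / (D0 + R0)"
  defines "c \<equiv> 1 / (\<tau>0 * enn2real p_star) * (R0 / (D0 + R0)) * \<eta>"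
  assumes "concave_enn f" and "usc f"
    and "bounded S0"
    and "m \<ge> 1"
    and "\<And>j. j \<in> {1..m} \<Longrightarrow> closed (S j)"
    and "\<And>j. j \<in> {1..m} \<Longrightarrow> convex (S j)"
    and "e0 \<in> interior S0" and "R0 > 0"
    and "\<And>j. j \<in> {1..m} \<Longrightarrow> e j \<in> interior (S j)"
    and "x_star \<in> Q" and "f x_star = p_star" and "p_star > 0"
    and "x_SL \<in> interior Q \<inter> pos_dom f" and "\<eta> > 0"
    and "x0 \<in> pos_dom f \<inter> Q"
    and "b \<ge> 2"
  shows "\<exists>K :: real \<Rightarrow> nat.
           (\<lambda>\<epsilon>. real (K \<epsilon>)) \<in> O[at_right 0](\<lambda>\<epsilon>. 1 / \<epsilon>\<^sup>2) \<and>
           (\<forall>\<epsilon> > 0. \<forall>N :: nat. N > 0 \<longrightarrow>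
              real N \<ge> log b (b * enn2real p_star / (c * \<rho> * \<epsilon>)) \<longrightarrow>
              (\<forall>z y \<tau> ybest.
                 parallel_multiradial subgrad_step f e0 \<phi> Q x0 b N z y \<tau> ybest \<longrightarrow>
                 (\<exists>i \<ge> 1. i \<le> K \<epsilon> \<and> ybest i \<in> Q \<and>
                    enn2real p_star - enn2real (f (ybest i)) \<le> \<epsilon>)))"
proof -
  define F where "F x = enn2real (f x)" for x
  define p where "p = enn2real p_star"
  define g where "g = minkowski_gauge S0 e0 x_star"
  have fin: "f x < \<infinity>" for x
    using concave_usc_finite[OF \<open>concave_enn f\<close> \<open>usc f\<close>] \<open>x_SL \<in> interior Q \<inter> pos_dom f\<close> by blast
  have f: "f x = ennreal (F x)" for x using fin[of x] by (simp add: F_def)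
  then have f': "f = (\<lambda>x. ennreal (F x))" by blast
  interpret radial_function F e0 R0
    using radial_function_enn2real[OF \<open>concave_enn f\<close> \<open>usc f\<close> fin] \<open>R0 > 0\<close>
    unfolding F_def R0_def S0_def by blast
  have "{x. 0 < F x} = pos_dom f"
    using fin by (auto simp: pos_dom_def F_def enn2real_positive_iff)
  then have S0: "S0 = pos" by (simp add: S0_def pos_def)
  have bdd: "bounded pos" using \<open>bounded S0\<close> S0 by simp
  have F_pos: "0 < F x \<longleftrightarrow> x \<in> pos_dom f" for x using \<open>{x. 0 < F x} = pos_dom f\<close> by blast
  have p_eq: "p = F x_star" using \<open>f x_star = p_star\<close> by (simp add: p_def F_def)
  have p: "0 < p" using \<open>p_star > 0\<close> fin[of x_star] \<open>f x_star = p_star\<close>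
    by (simp add: p_def enn2real_positive_iff)
  have F_le: "F x \<le> p" if "x \<in> Q" for x
    unfolding F_def p_def using that fin[of x_star] \<open>f x_star = p_star\<close>
    by (intro enn2real_mono) (auto simp: p_star_def intro: SUP_upper)
  have Q: "x \<in> S j" if "x \<in> Q" "j \<in> {1..m}" for x j using that by (simp add: Q_def)
  have x0: "x0 \<in> Q" "0 < F x0" and xl: "0 < F x_SL" and xs: "0 < F x_star"
    using assms p p_eq F_pos by auto
  have F0p: "F x0 \<le> p" using F_le x0 by blast
  \<comment> \<open>\<open>x_star\<close> lies in \<open>S0\<close>, so level 1 is admissible.
    Positivity of the product \<open>\<eta>\<close> then forces both of its factors to be
    positive.\<close>
  have "g \<le> 1"
    unfolding g_def S0 using mem_pos[OF xs] by (intro minkowski_gauge_le) auto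
  then have \<phi>xl: "\<phi> x_SL < 1" and g1: "g < 1"
    using \<open>\<eta> > 0\<close> unfolding \<eta>_def g_def[symmetric] by (auto simp: zero_less_mult_iff)
  have g0: "0 \<le> g" unfolding g_def using \<open>e0 \<in> interior S0\<close> by (rule minkowski_gauge_nonneg)
  have "1 \<in> {1..m}" using \<open>m \<ge> 1\<close> by simp
  then have \<phi>xl0: "0 \<le> \<phi> x_SL"
    unfolding \<phi>_def using minkowski_gauge_nonneg[OF assms(19)[of 1], of x_SL] minkowski_gauge_le_max_gauge[of 1 m S e x_SL]
    by linarith
  have \<phi>_comb: "\<phi> (x_star + l *\<^sub>R (x_SL - x_star)) \<le> 1 - l * (1 - \<phi> x_SL)" if l: "0 \<le> l" "l < 1" for l
    unfolding \<phi>_def max_gauge_le_iff[OF \<open>m \<ge> 1\<close>]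
  proof
    fix j assume j: "j \<in> {1..m}"
    have "minkowski_gauge (S j) (e j) (x_star + l *\<^sub>R (x_SL - x_star)) \<le> 1 - l * (1 - minkowski_gauge (S j) (e j) x_SL)"
      using j assms Q l by (intro minkowski_gauge_convex_comb) auto
    moreover have "l * minkowski_gauge (S j) (e j) x_SL \<le> l * max_gauge m S e x_SL"
      using minkowski_gauge_le_max_gauge[OF j] l by (intro mult_left_mono) auto
    ultimately show "minkowski_gauge (S j) (e j) (x_star + l *\<^sub>R (x_SL - x_star)) \<le> 1 - l * (1 - max_gauge m S e x_SL)"
      by (simp add: algebra_simps)
  qed
  have D0: "D0 = diameter pos" by (simp add: D0_def S0)
  have cv: "R0 * p \<le> D0 * F e0" unfolding p_eq D0 using center_value_ge[OF bdd xs] .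
  then have "0 < D0 * F e0" using p R_pos by (meson less_le_trans mult_pos_pos)
  then have D0_pos: "0 < D0" using center_pos by (simp add: zero_less_mult_iff)
  have DR: "0 < D0 + R0" using D0_pos R_pos by simp
  have \<rho>: "0 < \<rho>" "\<rho> < 1" using D0_pos R_pos DR by (simp_all add: \<rho>_def)
  have "D0 / R0 + 1 = (D0 + R0) / R0" using R_pos by (simp add: add_divide_distrib)
  then have q\<rho>: "(D0 / R0 + 1) * \<rho> = 1" using DR R_pos by (simp add: \<rho>_def)
  have \<eta>: "0 < \<eta>" "\<eta> \<le> 1"
    using \<open>\<eta> > 0\<close> mult_mono[of "1 - g" 1 "1 - \<phi> x_SL" 1] g0 g1 \<phi>xl \<phi>xl0
    unfolding \<eta>_def g_def[symmetric] by auto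
  have c_eq: "c = F x0 / p * (\<rho> * \<eta>)" by (simp add: c_def \<tau>0_def F_def p_def \<rho>_def)
  \<comment> \<open>As \<open>F x0 / p\<close> is at most 1, \<open>c\<close> is at most
    \<open>\<rho> * \<eta>\<close>, the rate at which the move towards \<open>x_SL\<close> lowers
    the objective.\<close>
  have "0 < F x0 / p" "F x0 / p \<le> 1" using x0 p F0p by simp_all
  then have c: "0 < c" "c \<le> \<rho> * \<eta>"
    using \<rho> \<eta> unfolding c_eq by (simp_all only: mult_pos_pos mult_left_le_one_le less_imp_le mult_nonneg_nonneg)
  define \<kappa> where "\<kappa> = p / (c * \<rho>)"
  have \<kappa>: "p \<le> \<kappa>"
  proof -
    have "\<rho> * \<eta> \<le> 1 * 1" using \<rho> \<eta> by (intro mult_mono) auto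
    then have "c * \<rho> \<le> 1 * 1" using c \<rho> by (intro mult_mono) auto
    then show ?thesis using c \<rho> p by (simp add: \<kappa>_def pos_le_divide_eq mult_left_le)
  qed
  obtain r where r: "0 < r" "\<And>y d. \<phi> (y + d) \<le> \<phi> y + norm d / r"
    using max_gauge_Lipschitz[OF \<open>m \<ge> 1\<close>, of S e] assms(16,19) unfolding \<phi>_def by blast
  \<comment> \<open>\<open>s\<close> is the gap \<open>p - 1 / \<tau>\<close> relative to
    \<open>p\<close>, and \<open>l\<close> is the move length from
    \<open>radial_objective_slater\<close>.\<close>
  define s where "s \<tau> = 1 - 1 / (\<tau> * p)" for \<tau>
  define l where "l \<tau> = \<rho> * ((1 - g) * s \<tau>)" for \<tau>
  define ref where "ref \<tau> = x_star + l \<tau> *\<^sub>R (x_SL - x_star)" for \<tau>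
  have \<tau>: "0 < \<tau>" "1 \<le> \<tau> * p" if "1 / p \<le> \<tau>" for \<tau>
    using that p less_le_trans[OF _ that, of 0] by (auto simp: pos_divide_le_eq)
  have ref: "0 \<le> l \<tau>" "l \<tau> < 1" "radial_objective f e0 \<phi> \<tau> (ref \<tau>) \<le> ereal (1 - l \<tau> * (1 - \<phi> x_SL))"
    if "1 / p \<le> \<tau>" for \<tau>
    using radial_objective_slater[OF bdd xs xl, of \<tau> \<phi>] \<tau>[OF that] g1 \<phi>xl \<phi>xl0 \<phi>_comb
    unfolding ref_def l_def s_def \<rho>_def g_def S0 D0 p_eq f' by simp_all
  interpret multiradial f F e0 \<phi> Q x0 b p \<kappa> "D0 / R0" "max (1 / R0) (1 / r)" D0 ref
  proof
    show "f x = ennreal (F x)" "0 \<le> F x" for x by (rule f, rule nonneg)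
    show "x0 \<in> Q" "0 < F x0" "2 \<le> b" "p \<le> \<kappa>" "\<And>x. x \<in> Q \<Longrightarrow> F x \<le> p"
      by (fact x0 \<open>b \<ge> 2\<close> \<kappa> F_le)+
    show "0 < max (1 / R0) (1 / r)" using R_pos by (simp add: less_max_iff_disj)
    show "norm g \<le> max (1 / R0) (1 / r)"
      if "1 / p \<le> \<tau>" "g \<in> subdifferential (radial_objective f e0 \<phi> \<tau>) y" for \<tau> g y
      using subgradient_bound[OF \<tau>(1)[OF that(1)] r] that(2) unfolding f' .
    show "y \<in> Q \<and> 1 + \<delta> \<le> \<tau> * F y"
      if \<delta>: "0 < \<delta>" and t: "1 / p \<le> \<tau>" and le: "radial_objective f e0 \<phi> \<tau> y \<le> ereal (1 - D0 / R0 * \<delta>)" for \<delta> \<tau> y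
    proof -
      note le = le[unfolded f']
      \<comment> \<open>\<open>k \<le> 1\<close> because the objective is nonnegative. The factor
        \<open>D0 / R0\<close> is compensated by \<open>R0 * p \<le> D0 * F e0\<close>, so
        \<open>radial_gain\<close> yields the full \<open>\<delta>\<close>.\<close>
      define k where "k = D0 / R0 * \<delta>"
      have k: "0 < k" "k \<le> 1"
        using \<delta> D0_pos R_pos radial_objective_nonneg[OF le] by (auto simp: k_def)
      have *: "radial \<tau> y \<le> ennreal (1 - k)" "\<phi> y \<le> 1 - k"
        using le k radial_objective_le_iff[of "1 - k" \<phi> \<tau> y] unfolding k_def[symmetric] by simp_all
      have "\<delta> * 1 \<le> \<delta> * (\<tau> * p)" using \<delta> \<tau>[OF t] by (intro mult_left_mono) auto
      also have "\<dots> = \<delta> * \<tau> / R0 * (R0 * p)" using R_pos by simp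
      also have "\<dots> \<le> \<delta> * \<tau> / R0 * (D0 * F e0)"
        using cv \<delta> \<tau>[OF t] R_pos by (intro mult_left_mono) auto
      also have "\<dots> = k * (\<tau> * F e0)" by (simp add: k_def)
      finally have "1 + \<delta> \<le> \<tau> * F y" using radial_gain[OF \<tau>(1)[OF t] *(1) k] by simp
      moreover have "y \<in> S j" if j: "j \<in> {1..m}" for j
      proof (rule mem_if_minkowski_gauge_le_1)
        show "closed (S j)" "convex (S j)" "e j \<in> interior (S j)" using assms j by auto
        show "minkowski_gauge (S j) (e j) y \<le> 1"
          using minkowski_gauge_le_max_gauge[OF j, of S e y] *(2) k unfolding \<phi>_def by linarith
      qed
      ultimately show ?thesis by (simp add: Q_def)
    qed
    show "radial_objective f e0 \<phi> \<tau> (ref \<tau>) \<le> ereal (1 - (D0 / R0 + 1) * \<delta>)"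
      if \<delta>: "0 < \<delta>" and t: "1 / p \<le> \<tau>" and gap: "\<kappa> * \<delta> \<le> p - 1 / \<tau>" for \<delta> \<tau>
    proof -
      \<comment> \<open>The gap gives \<open>\<delta> \<le> s \<tau> * c * \<rho>\<close>.
        Multiplying by \<open>D0 / R0 + 1\<close>, the inverse of \<open>\<rho>\<close>, leaves
        \<open>s \<tau> * c\<close>, which the decrease at \<open>ref \<tau>\<close>
        dominates.\<close>
      have "p - 1 / \<tau> = p * s \<tau>" using p \<tau>[OF t] by (simp add: s_def field_simps)
      then have "p * \<delta> \<le> p * s \<tau> * (c * \<rho>)" using gap c \<rho> by (simp add: \<kappa>_def pos_divide_le_eq)
      then have "\<delta> \<le> s \<tau> * c * \<rho>" using p by (simp add: mult.assoc)
      then have "(D0 / R0 + 1) * \<delta> \<le> (D0 / R0 + 1) * (s \<tau> * c * \<rho>)"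
        using D0_pos R_pos by (intro mult_left_mono) auto
      also have "\<dots> = s \<tau> * c" using q\<rho> by (metis mult.assoc mult.commute mult_1_right)
      also have "\<dots> \<le> s \<tau> * (\<rho> * \<eta>)"
        using c \<tau>[OF t] by (intro mult_left_mono) (auto simp: s_def divide_le_eq_1)
      also have "\<dots> = l \<tau> * (1 - \<phi> x_SL)" by (simp add: l_def \<eta>_def g_def)
      finally have "ereal (1 - l \<tau> * (1 - \<phi> x_SL)) \<le> ereal (1 - (D0 / R0 + 1) * \<delta>)" by simp
      then show ?thesis using ref(3)[OF t] by (rule order_trans[rotated])
    qed
    show "norm (y - ref \<tau>) \<le> D0" if "0 < F y" and t: "1 / p \<le> \<tau>" for y \<tau>
    proof -
      have "(1 - l \<tau>) *\<^sub>R x_star + l \<tau> *\<^sub>R x_SL \<in> pos"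
        using ref[OF t] mem_pos xs xl by (intro convexD[OF convex_pos]) auto
      also have "(1 - l \<tau>) *\<^sub>R x_star + l \<tau> *\<^sub>R x_SL = ref \<tau>" by (simp add: ref_def algebra_simps)
      finally show ?thesis
        using diameter_bounded_bound[OF bdd mem_pos[OF that(1)]] by (simp add: D0 dist_norm)
    qed
  qed
  show ?thesis
  \<comment> \<open>The witness is fixed before \<open>N\<close> and the run, so the constant in the
    bound depends on neither.\<close>
  proof (intro exI[of _ "\<lambda>\<epsilon>. phase_end (LEAST l. \<kappa> \<le> \<epsilon> * b ^ l)"] conjI allI impI)
    show "(\<lambda>\<epsilon>. real (phase_end (LEAST l. \<kappa> \<le> \<epsilon> * b ^ l))) \<in> O[at_right 0](\<lambda>\<epsilon>. 1 / \<epsilon>\<^sup>2)"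
      by (rule phase_end_bigo)
    fix \<epsilon> :: real and N z y \<tau> ybest
    assume "0 < \<epsilon>" "0 < N" and N: "log b (b * enn2real p_star / (c * \<rho> * \<epsilon>)) \<le> real N"
      and run: "parallel_multiradial subgrad_step f e0 \<phi> Q x0 b N z y \<tau> ybest"
    interpret multiradial_run f F e0 \<phi> Q x0 b p \<kappa> "D0 / R0" "max (1 / R0) (1 / r)" D0 ref N z y \<tau> ybest
      by unfold_locales (fact run \<open>0 < N\<close>)+
    have "log b (b * \<kappa> / \<epsilon>) \<le> real N" using N by (simp add: \<kappa>_def p_def)
    from convergence[OF \<open>0 < \<epsilon>\<close> this]
    show "\<exists>i\<ge>1. i \<le> phase_end (LEAST l. \<kappa> \<le> \<epsilon> * b ^ l) \<and> ybest i \<in> Q \<and>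
        enn2real p_star - enn2real (f (ybest i)) \<le> \<epsilon>"
      by (simp add: F_def p_def)
  qed
qed

end
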